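(* Let $B^{(H)}\colon L^2(0,1)\to\ell^2$, $[B^{(H)}z]_j=\int_0^1t^{j-1}z(t)\,dt$ $(j=1,2,\dots)$, be the Hausdorff moment operator, let $J\colon L^2(0,1)\to L^2(0,1)$, $[Jx](s)=\int_0^sx(t)\,dt$, be the integration operator, and for $k\in\mathbb{N}$ let $\mathcal{E}^{(k)}\colon H^k(0,1)\hookrightarrow L^2(0,1)$ be the natural embedding. There are constants $C_k>0$, depending on $k=0,1,2,\dots$, such that the following hold. (a) For every $k\in\mathbb{N}$, the bound $$\sup\{\,\|x\|_{L^2(0,1)}:\ \|B^{(H)}(\mathcal{E}^{(k)}x)\|_{\ell^2}\le\delta,\ \|x\|_{H^k(0,1)}\le1\}\le\frac{C_k}{(\ln(1/\delta))^k}$$ holds for sufficiently small $\delta>0$. (b) The bound $$\sup\{\,\|Jx\|_{L^2(0,1)}:\ \|B^{(H)}(Jx)\|_{\ell^2}\le\delta,\ \|x\|_{L^2(0,1)}\le1\}\le\frac{C_0}{\ln(1/\delta)}$$ holds for sufficiently small $\delta>0$.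
   Context: All function spaces are real. $H^k(0,1)$ is the $L^2$-based Sobolev space of integer order $k$ on $(0,1)$ with its usual norm; $\mathbb{N}=\{1,2,\dots\}$. *)

theory Defs
  imports "HOL-Analysis.Analysis"
begin

text \<open>
  Elements of the real space $L^2(0,1)$ and of its Sobolev subspaces are handled through
  representatives \<open>real \<Rightarrow> real\<close>, whose values outside $(0,1)$ are irrelevant.
  The natural embedding of $H^k(0,1)$ into $L^2(0,1)$ is then the identity on representatives.
\<close>

abbreviation unit_interval :: "real measure" where
  "unit_interval \<equiv> lebesgue_on {0<..<1}"

definition L2 :: "(real \<Rightarrow> real) set" where
  "L2 = {f \<in> borel_measurable unit_interval. integrable unit_interval (\<lambda>t. (f t)\<^sup>2)}"

definition L2_norm :: "(real \<Rightarrow> real) \<Rightarrow> real" where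
  "L2_norm f = sqrt (\<integral>t. (f t)\<^sup>2 \<partial>unit_interval)"

definition test_function :: "(real \<Rightarrow> real) \<Rightarrow> bool" where
  "test_function \<phi> \<longleftrightarrow>
     (\<forall>n x. ((deriv ^^ n) \<phi>) differentiable (at x)) \<and>
     (\<exists>a b. 0 < a \<and> b < 1 \<and> (\<forall>x. x \<notin> {a..b} \<longrightarrow> \<phi> x = 0))"

definition has_weak_deriv :: "nat \<Rightarrow> (real \<Rightarrow> real) \<Rightarrow> (real \<Rightarrow> real) \<Rightarrow> bool" where
  "has_weak_deriv n f g \<longleftrightarrow>
     (\<forall>\<phi>. test_function \<phi> \<longrightarrow>
        (\<integral>t. f t * (deriv ^^ n) \<phi> t \<partial>unit_interval) =
        (-1) ^ n * (\<integral>t. g t * \<phi> t \<partial>unit_interval))"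

definition Sobolev :: "nat \<Rightarrow> (real \<Rightarrow> real) set" where
  "Sobolev k = {f \<in> L2. \<forall>i\<le>k. \<exists>g\<in>L2. has_weak_deriv i f g}"

text \<open>
  The weak derivative is determined up to a null set, so the choice of representative
  does not affect its norm.
\<close>

definition weak_deriv :: "nat \<Rightarrow> (real \<Rightarrow> real) \<Rightarrow> (real \<Rightarrow> real)" where
  "weak_deriv i f = (SOME g. g \<in> L2 \<and> has_weak_deriv i f g)"

definition Sobolev_norm :: "nat \<Rightarrow> (real \<Rightarrow> real) \<Rightarrow> real" where
  "Sobolev_norm k f = sqrt (\<Sum>i\<le>k. (L2_norm (weak_deriv i f))\<^sup>2)"

definition ell2 :: "(nat \<Rightarrow> real) set" where
  "ell2 = {a. summable (\<lambda>j. (a j)\<^sup>2)}"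

definition ell2_norm :: "(nat \<Rightarrow> real) \<Rightarrow> real" where
  "ell2_norm a = sqrt (\<Sum>j. (a j)\<^sup>2)"

text \<open>Sequences are indexed from 0: entry \<open>j\<close> below is entry $j+1$ of a sequence indexed from 1.\<close>

definition hausdorff_moments :: "(real \<Rightarrow> real) \<Rightarrow> nat \<Rightarrow> real" where
  "hausdorff_moments z j = (\<integral>t. t ^ j * z t \<partial>unit_interval)"

definition integration_op :: "(real \<Rightarrow> real) \<Rightarrow> real \<Rightarrow> real" where
  "integration_op x s = (\<integral>t. x t \<partial>(lebesgue_on {0<..<s}))"

text \<open>
  The operators are well defined: the moment integrals converge, and both operators map into the
  spaces stated. The bound for the moments is Hilbert's inequality with a non-optimal constant.
\<close>

lemma finite_measure_unit_interval: "finite_measure unit_interval"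
  by (rule finite_measure_lebesgue_on) simp

lemma L2_times_integrable:
  assumes "f \<in> L2" "g \<in> L2"
  shows "integrable unit_interval (\<lambda>t. f t * g t)"
proof (rule Bochner_Integration.integrable_bound)
  show "integrable unit_interval (\<lambda>t. (f t)\<^sup>2 + (g t)\<^sup>2)"
    using assms by (auto simp: L2_def)
  show "(\<lambda>t. f t * g t) \<in> borel_measurable unit_interval"
    using assms by (auto simp: L2_def)
  have "\<bar>a * b\<bar> \<le> a\<^sup>2 + b\<^sup>2" for a b :: real
  proof -
    have "2 * (\<bar>a\<bar> * \<bar>b\<bar>) \<le> a\<^sup>2 + b\<^sup>2"
      using sum_squares_bound[of "\<bar>a\<bar>" "\<bar>b\<bar>"] by (simp add: mult.assoc)
    moreover have "0 \<le> \<bar>a\<bar> * \<bar>b\<bar>" by simp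
    ultimately show ?thesis unfolding abs_mult by linarith
  qed
  then show "AE t in unit_interval. norm (f t * g t) \<le> norm ((f t)\<^sup>2 + (g t)\<^sup>2)"
    by (intro AE_I2) simp
qed

lemma bounded_measurable_L2:
  assumes "f \<in> borel_measurable unit_interval" "\<And>t. 0 < t \<Longrightarrow> t < 1 \<Longrightarrow> \<bar>f t\<bar> \<le> M"
  shows "f \<in> L2"
proof -
  interpret finite_measure unit_interval by (rule finite_measure_unit_interval)
  have "integrable unit_interval (\<lambda>t. (f t)\<^sup>2)"
  proof (rule integrable_const_bound)
    show "AE t in unit_interval. norm ((f t)\<^sup>2) \<le> M\<^sup>2"
      using assms(2) by (intro AE_I2) (auto simp: abs_le_square_iff[symmetric] intro: order_trans[OF _ abs_ge_self])
    show "(\<lambda>t. (f t)\<^sup>2) \<in> borel_measurable unit_interval"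
      using assms(1) by simp
  qed
  then show ?thesis using assms(1) by (simp add: L2_def)
qed

lemma continuous_bounded_L2:
  assumes "continuous_on {0..1} f"
  shows "f \<in> L2"
proof -
  have "compact (f ` {0..1})" using assms by (intro compact_continuous_image) auto
  then obtain M where "\<forall>t\<in>{0..1}. \<bar>f t\<bar> \<le> M"
    using compact_imp_bounded bounded_iff by (metis imageI real_norm_def)
  moreover have "f \<in> borel_measurable unit_interval"
    by (intro continuous_imp_measurable_on_sets_lebesgue continuous_on_subset[OF assms]) auto
  ultimately show ?thesis by (intro bounded_measurable_L2[of f M]) auto
qed

lemma hausdorff_moments_integrable:
  "z \<in> L2 \<Longrightarrow> integrable unit_interval (\<lambda>t. t ^ j * z t)"
  by (intro L2_times_integrable continuous_bounded_L2[of "\<lambda>t. t ^ j"] continuous_intros)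

lemma integral_power_unit_interval:
  "(\<integral>t. t ^ n \<partial>unit_interval) = 1 / (real n + 1)"
proof -
  have "integrable unit_interval (\<lambda>t. t ^ n * 1)"
    by (intro L2_times_integrable continuous_bounded_L2 continuous_intros)
  then have "(\<integral>t. t ^ n \<partial>unit_interval) = integral {0<..<1} (\<lambda>t. t ^ n)"
    by (intro lebesgue_integral_eq_integral) auto
  also have "\<dots> = integral {0..1} (\<lambda>t. t ^ n)"
    by (simp add: integral_open_interval_real)
  also have "\<dots> = 1 / (real n + 1)"
  proof -
    have "((\<lambda>t::real. t ^ n) has_integral (1 ^ Suc n / real (Suc n) - 0 ^ Suc n / real (Suc n))) {0..1}"
      by (intro fundamental_theorem_of_calculus)
        (auto intro!: derivative_eq_intros
           simp: has_real_derivative_iff_has_vector_derivative[symmetric] simp del: power_Suc of_nat_Suc)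
    then show ?thesis by (simp add: integral_unique add.commute)
  qed
  finally show ?thesis .
qed

lemma sum_inverse_sqrt_le: "(\<Sum>j<n. 1 / sqrt (real j + 1)) \<le> 2 * sqrt (real n)"
proof (induction n)
  case (Suc n)
  define a b where "a = sqrt (real n)" and "b = sqrt (real n + 1)"
  have ab: "0 \<le> a" "0 < b" "b\<^sup>2 = a\<^sup>2 + 1" by (auto simp: a_def b_def)
  have "0 \<le> (b - a)\<^sup>2" by simp
  then have "1 + 2 * a * b \<le> 2 * b * b"
    using ab by (simp add: power2_eq_square algebra_simps)
  then have "1 / b \<le> 2 * b - 2 * a" using ab by (simp add: field_simps)
  then show ?case using Suc by (simp add: a_def b_def add.commute)
qed simp

lemma sum_inverse_power_le:
  assumes "1 \<le> i"
  shows "(\<Sum>j=i..<n. 1 / ((real j + 1) * sqrt (real j + 1))) \<le> 2 / sqrt (real i)"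
proof -
  have "(\<Sum>j=i..<n. 1 / ((real j + 1) * sqrt (real j + 1))) \<le> 2 / sqrt (real i) - 2 / sqrt (real n)"
    if "i \<le> n" for n using that
  proof (induction n rule: dec_induct)
    case (step n)
    define a b where "a = sqrt (real n)" and "b = sqrt (real n + 1)"
    have "n \<ge> 1" using step assms by linarith
    then have ab: "0 < a" "a \<le> b" "b\<^sup>2 = a\<^sup>2 + 1" "real n + 1 = b\<^sup>2" by (auto simp: a_def b_def)
    then have "0 < b" by linarith
    have "(b - a) * (b + a) = 1" using ab by (simp add: power2_eq_square algebra_simps)
    moreover have "(b - a) * (b + a) \<le> (b - a) * (2 * b)"
      using ab by (intro mult_left_mono) auto
    ultimately have "1 \<le> 2 * b * (b - a)" by (simp add: algebra_simps)
    then have "a * 1 \<le> b * (2 * b * (b - a))"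
      using ab \<open>0 < b\<close> by (intro mult_mono) auto
    then have "1 / (b\<^sup>2 * b) \<le> 2 / a - 2 / b"
      using ab(1) \<open>0 < b\<close> by (simp add: field_simps power2_eq_square)
    then show ?case using step ab(4) \<open>0 < b\<close>
      by (simp add: a_def[symmetric] b_def[symmetric] add.commute[of 1])
  qed simp
  from this[of n] show ?thesis
  proof (cases "i \<le> n")
    case True
    moreover have "0 \<le> 2 / sqrt (real n)" by simp
    ultimately show ?thesis using \<open>i \<le> n \<Longrightarrow> _\<close> by linarith
  qed auto
qed

lemma schur_weight_bound:
  "(\<Sum>j<n. sqrt (real i + 1) / ((real i + real j + 1) * sqrt (real j + 1))) \<le> 4"
proof -
  define f where "f j = sqrt (real i + 1) / ((real i + real j + 1) * sqrt (real j + 1))" for j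
  have f0: "0 \<le> f j" for j by (simp add: f_def)
  have "(\<Sum>j<n. f j) \<le> (\<Sum>j\<in>{..<Suc i} \<union> {Suc i..<n}. f j)"
    by (intro sum_mono2) (auto simp: f0)
  also have "\<dots> = (\<Sum>j<Suc i. f j) + (\<Sum>j=Suc i..<n. f j)"
    by (intro sum.union_disjoint) auto
  also have "(\<Sum>j<Suc i. f j) \<le> (\<Sum>j<Suc i. 1 / sqrt (real i + 1) * (1 / sqrt (real j + 1)))"
  proof (intro sum_mono)
    fix j
    have s: "sqrt (real i + 1) / (real i + 1) = 1 / sqrt (real i + 1)"
      using real_sqrt_mult_self[of "real i + 1"] by (simp add: divide_simps)
    have "f j \<le> sqrt (real i + 1) / ((real i + 1) * sqrt (real j + 1))"
      unfolding f_def by (intro divide_left_mono mult_right_mono mult_pos_pos) auto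
    also have "\<dots> = (sqrt (real i + 1) / (real i + 1)) * (1 / sqrt (real j + 1))" by simp
    finally show "f j \<le> 1 / sqrt (real i + 1) * (1 / sqrt (real j + 1))" unfolding s .
  qed
  also have "\<dots> = 1 / sqrt (real i + 1) * (\<Sum>j<Suc i. 1 / sqrt (real j + 1))"
    by (rule sum_distrib_left[symmetric])
  also have "\<dots> \<le> 1 / sqrt (real i + 1) * (2 * sqrt (real (Suc i)))"
    by (intro mult_left_mono sum_inverse_sqrt_le) auto
  also have "\<dots> = 2" by (simp add: add.commute)
  also have "(\<Sum>j=Suc i..<n. f j) \<le>
      (\<Sum>j=Suc i..<n. sqrt (real i + 1) * (1 / ((real j + 1) * sqrt (real j + 1))))"
    unfolding f_def times_divide_eq_right mult_1_right
    by (intro sum_mono divide_left_mono mult_right_mono mult_pos_pos) auto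
  also have "\<dots> = sqrt (real i + 1) * (\<Sum>j=Suc i..<n. 1 / ((real j + 1) * sqrt (real j + 1)))"
    by (rule sum_distrib_left[symmetric])
  also have "\<dots> \<le> sqrt (real i + 1) * (2 / sqrt (real (Suc i)))"
    by (intro mult_left_mono sum_inverse_power_le) auto
  also have "\<dots> = 2" by (simp add: add.commute)
  finally show ?thesis by (simp add: f_def)
qed

lemma hilbert_inequality_finite:
  fixes a :: "nat \<Rightarrow> real"
  shows "(\<Sum>i<n. \<Sum>j<n. a i * a j / (real i + real j + 1)) \<le> 4 * (\<Sum>i<n. (a i)\<^sup>2)"
proof -
  define w where "w i j = sqrt (real i + 1) / ((real i + real j + 1) * sqrt (real j + 1))" for i j
  have pt: "a i * a j / (real i + real j + 1) \<le> ((a i)\<^sup>2 * w i j + (a j)\<^sup>2 * w j i) / 2" for i j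
  proof -
    define p q where "p = sqrt (real i + 1)" and "q = sqrt (real j + 1)"
    have pq: "0 < p" "0 < q" by (auto simp: p_def q_def)
    have "2 * (a i * p) * (a j * q) \<le> (a i * p)\<^sup>2 + (a j * q)\<^sup>2" by (rule sum_squares_bound)
    then have "(2 * (a i * p) * (a j * q)) / (p * q) \<le> ((a i * p)\<^sup>2 + (a j * q)\<^sup>2) / (p * q)"
      using pq by (intro divide_right_mono) auto
    then have "2 * (a i * a j) \<le> (a i)\<^sup>2 * (p / q) + (a j)\<^sup>2 * (q / p)"
      using pq by (simp add: field_simps power2_eq_square)
    then have "(2 * (a i * a j)) / (real i + real j + 1)
        \<le> ((a i)\<^sup>2 * (p / q) + (a j)\<^sup>2 * (q / p)) / (real i + real j + 1)"
      by (intro divide_right_mono) auto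
    moreover have "w i j = (p / q) / (real i + real j + 1)" "w j i = (q / p) / (real i + real j + 1)"
      unfolding w_def p_def[symmetric] q_def[symmetric] by (simp_all add: add.commute[of "real j"] mult.commute)
    ultimately have "2 * (a i * a j) / (real i + real j + 1) \<le> (a i)\<^sup>2 * w i j + (a j)\<^sup>2 * w j i"
      by (simp only: add_divide_distrib times_divide_eq_right)
    moreover have "x \<le> y / 2" if "2 * x \<le> y" for x y :: real using that by simp
    ultimately show ?thesis by (simp only: times_divide_eq_right)
  qed
  have wb: "(\<Sum>j<n. w i j) \<le> 4" for i unfolding w_def by (rule schur_weight_bound)
  have "(\<Sum>i<n. \<Sum>j<n. a i * a j / (real i + real j + 1))
      \<le> (\<Sum>i<n. \<Sum>j<n. ((a i)\<^sup>2 * w i j + (a j)\<^sup>2 * w j i) / 2)"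
    by (intro sum_mono pt)
  also have "\<dots> = ((\<Sum>i<n. \<Sum>j<n. (a i)\<^sup>2 * w i j) + (\<Sum>i<n. \<Sum>j<n. (a j)\<^sup>2 * w j i)) / 2"
    by (simp only: sum.distrib sum_divide_distrib[symmetric])
  also have "(\<Sum>i<n. \<Sum>j<n. (a j)\<^sup>2 * w j i) = (\<Sum>i<n. \<Sum>j<n. (a i)\<^sup>2 * w i j)"
    by (rule sum.swap)
  also have "((\<Sum>i<n. \<Sum>j<n. (a i)\<^sup>2 * w i j) + (\<Sum>i<n. \<Sum>j<n. (a i)\<^sup>2 * w i j)) / 2
      = (\<Sum>i<n. (a i)\<^sup>2 * (\<Sum>j<n. w i j))"
    by (simp only: sum_distrib_left field_sum_of_halves add_divide_distrib)
  also have "\<dots> \<le> (\<Sum>i<n. (a i)\<^sup>2 * 4)"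
    by (intro sum_mono mult_left_mono wb) auto
  finally show ?thesis by (simp add: sum_distrib_left mult.commute)
qed

lemma hausdorff_moments_in_ell2:
  assumes z: "z \<in> L2"
  shows "hausdorff_moments z \<in> ell2"
proof -
  define a where "a = hausdorff_moments z"
  have z2: "integrable unit_interval (\<lambda>t. (z t)\<^sup>2)" using z by (simp add: L2_def)
  have "(\<Sum>j<n. (a j)\<^sup>2) \<le> 4 * (\<integral>t. (z t)\<^sup>2 \<partial>unit_interval)" for n
  proof -
    define p where "p t = (\<Sum>j<n. a j * t ^ j)" for t :: real
    define S where "S = (\<Sum>j<n. (a j)\<^sup>2)"
    have p: "p \<in> L2" unfolding p_def by (intro continuous_bounded_L2 continuous_intros)
    have p2: "integrable unit_interval (\<lambda>t. (p t)\<^sup>2)" using p by (simp add: L2_def)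
    have pows: "integrable unit_interval (\<lambda>t. t ^ i * t ^ j)" for i j
      by (intro L2_times_integrable continuous_bounded_L2 continuous_intros)
    have "(\<integral>t. p t * z t \<partial>unit_interval) = (\<integral>t. (\<Sum>j<n. a j * (t ^ j * z t)) \<partial>unit_interval)"
      by (simp add: p_def sum_distrib_right mult.assoc)
    also have "\<dots> = (\<Sum>j<n. a j * (\<integral>t. t ^ j * z t \<partial>unit_interval))"
      using hausdorff_moments_integrable[OF z] by (subst Bochner_Integration.integral_sum) auto
    also have "\<dots> = S" by (simp add: S_def a_def hausdorff_moments_def power2_eq_square)
    finally have pz: "(\<integral>t. p t * z t \<partial>unit_interval) = S" .
    have "(\<integral>t. (p t)\<^sup>2 \<partial>unit_interval) =
        (\<integral>t. (\<Sum>i<n. \<Sum>j<n. a i * a j * (t ^ i * t ^ j)) \<partial>unit_interval)"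
      by (simp add: p_def power2_eq_square sum_product mult_ac)
    also have "\<dots> = (\<Sum>i<n. \<Sum>j<n. a i * a j * (\<integral>t. t ^ i * t ^ j \<partial>unit_interval))"
      using pows by (simp add: Bochner_Integration.integral_sum)
    also have "\<dots> = (\<Sum>i<n. \<Sum>j<n. a i * a j / (real i + real j + 1))"
      by (simp add: power_add[symmetric] integral_power_unit_interval)
    also have "\<dots> \<le> 4 * S" unfolding S_def by (rule hilbert_inequality_finite)
    finally have pp: "(\<integral>t. (p t)\<^sup>2 \<partial>unit_interval) \<le> 4 * S" .
    have "(\<integral>t. p t * z t \<partial>unit_interval) \<le> (\<integral>t. (p t)\<^sup>2 / 8 + 2 * (z t)\<^sup>2 \<partial>unit_interval)"
    proof (intro integral_mono L2_times_integrable p z)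
      show "integrable unit_interval (\<lambda>t. (p t)\<^sup>2 / 8 + 2 * (z t)\<^sup>2)" using p2 z2 by simp
      show "p t * z t \<le> (p t)\<^sup>2 / 8 + 2 * (z t)\<^sup>2" for t
        using sum_squares_bound[of "p t / 4" "z t"] zero_le_power2[of "p t - 4 * z t"]
        by (simp add: power2_eq_square algebra_simps)
    qed
    also have "\<dots> = (\<integral>t. (p t)\<^sup>2 \<partial>unit_interval) / 8 + 2 * (\<integral>t. (z t)\<^sup>2 \<partial>unit_interval)"
      using p2 z2 by simp
    finally show ?thesis using pz pp by (simp add: S_def)
  qed
  then have "summable (\<lambda>j. (a j)\<^sup>2)"
    by (intro summableI_nonneg_bounded) auto
  then show ?thesis by (simp add: ell2_def a_def)
qed

lemma integration_op_in_L2: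
  assumes x: "x \<in> L2"
  shows "integration_op x \<in> L2"
proof -
  have "(\<lambda>t. 1) \<in> L2" by (intro continuous_bounded_L2 continuous_intros)
  from L2_times_integrable[OF this x] have i: "integrable unit_interval x" by simp
  have "x integrable_on {0<..<1}" using integrable_on_lebesgue_on[OF i] by simp
  then have "x integrable_on {0..1}" by (simp add: integrable_on_open_interval_real)
  then have c: "continuous_on {0..1} (\<lambda>s. integral {0..s} x)"
    by (rule indefinite_integral_continuous_1)
  have "integration_op x s = integral {0..s} x" if "s \<in> {0..1}" for s
  proof -
    have "integrable (lebesgue_on {0<..<s}) x"
    proof -
      have "set_integrable lebesgue {0<..<1} x"
        using i by (simp add: set_integrable_def integrable_restrict_space)
      then have "set_integrable lebesgue {0<..<s} x"
        by (rule set_integrable_subset) (use that in auto)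
      then show ?thesis by (simp add: set_integrable_def integrable_restrict_space)
    qed
    then have "integration_op x s = integral {0<..<s} x"
      unfolding integration_op_def by (intro lebesgue_integral_eq_integral) auto
    then show ?thesis by (simp add: integral_open_interval_real)
  qed
  then have "continuous_on {0..1} (integration_op x)"
    using c by (metis (no_types, lifting) continuous_on_cong)
  then show ?thesis by (rule continuous_bounded_L2)
qed

end

(*
  Polynomials of degree at most n are determined stably by the first n + 1 moments up to a factor that
  grows exponentially in n: expanding in shifted Legendre polynomials, whose coefficients sum up to at
  most 6^m, the projection of x onto these polynomials has squared norm at most 9 * 216^n * delta^2 if
  the moments of x have norm at most delta. On the other hand, the Legendre polynomials are the
  eigenfunctions of p |-> -(t (1 - t) p')' with eigenvalues m (m + 1), so that each weak derivative in
  L^2 gains a factor 1 / (n + 1) in the distance of x to these polynomials. Hence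
  |x|^2 <= (n + 1)^(-2k) + 9 * 216^(n + k) * delta^2 for all n, and n ~ ln (1 / delta) / 8 gives the bounds.
*)
theory Submission
  imports Defs
begin

section \<open>Square-integrable functions and polynomials\<close>

text \<open>The obstacle is that a representative with a weak derivative has no usable boundary
  values. The Legendre operator tolerates this: its leading coefficient t(1-t) vanishes at both
  endpoints, so integration by parts leaves no boundary terms, and the derivative has to be known
  only against polynomials of the form t(1-t)s. That knowledge controls the sum of the squared
  Legendre components weighted by m(m+1), which is where the factor 1/(n+1) comes from. Each
  derivative costs one degree, because a primitive of a polynomial of degree n has degree n+1; this
  is the k in the exponent n+k. The base 216 is 6^3: two factors 6^m from squaring the coefficient
  sum, one from a crude lower bound for the squared norm of the m-th Legendre polynomial. A sharper
  base would only improve constants. With L = ln(1/delta), the choice of n near L/8 ensures 216^n <=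
  1/delta, so that 216^n * delta^2 <= delta, which is eventually below every power of 1/L.\<close>

definition L2_inner :: "(real \<Rightarrow> real) \<Rightarrow> (real \<Rightarrow> real) \<Rightarrow> real" where
  "L2_inner f g = (\<integral>t. f t * g t \<partial>unit_interval)"

lemma L2_add [intro]: "f \<in> L2 \<Longrightarrow> g \<in> L2 \<Longrightarrow> (\<lambda>t. f t + g t) \<in> L2"
  using L2_times_integrable[of f g]
  by (auto simp: L2_def power2_sum mult.assoc)

lemma L2_scale [intro]: "f \<in> L2 \<Longrightarrow> (\<lambda>t. c * f t) \<in> L2"
  by (auto simp: L2_def power_mult_distrib)

lemma L2_diff [intro]: "f \<in> L2 \<Longrightarrow> g \<in> L2 \<Longrightarrow> (\<lambda>t. f t - g t) \<in> L2"
  using L2_add[of f "\<lambda>t. (-1) * g t"] L2_scale[of g "-1"] by simp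

lemma poly_L2 [intro]: "poly p \<in> L2"
  by (intro continuous_bounded_L2 continuous_intros)

lemma L2_inner_commute: "L2_inner f g = L2_inner g f"
  by (simp add: L2_inner_def mult.commute)

lemma L2_inner_diff_left:
  "f \<in> L2 \<Longrightarrow> g \<in> L2 \<Longrightarrow> h \<in> L2 \<Longrightarrow> L2_inner (\<lambda>t. f t - g t) h = L2_inner f h - L2_inner g h"
  using L2_times_integrable by (simp add: L2_inner_def left_diff_distrib)

lemma L2_inner_poly_0 [simp]: "L2_inner f (poly 0) = 0"
  by (simp add: L2_inner_def)

lemma L2_inner_poly_add:
  "f \<in> L2 \<Longrightarrow> L2_inner f (poly (p + q)) = L2_inner f (poly p) + L2_inner f (poly q)"
  using L2_times_integrable[OF _ poly_L2, of f] by (simp add: L2_inner_def distrib_left)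

lemma L2_inner_poly_diff:
  "f \<in> L2 \<Longrightarrow> L2_inner f (poly (p - q)) = L2_inner f (poly p) - L2_inner f (poly q)"
  using L2_times_integrable[OF _ poly_L2, of f] by (simp add: L2_inner_def right_diff_distrib)

lemma L2_inner_poly_smult: "L2_inner f (poly (smult c p)) = c * L2_inner f (poly p)"
  by (simp add: L2_inner_def mult.left_commute)

lemma L2_inner_poly_sum:
  "f \<in> L2 \<Longrightarrow> L2_inner f (poly (\<Sum>i\<in>I. p i)) = (\<Sum>i\<in>I. L2_inner f (poly (p i)))"
  by (induction I rule: infinite_finite_induct) (auto simp: L2_inner_poly_add simp del: poly_add)

lemma L2_inner_self_nonneg: "0 \<le> L2_inner f f"
  by (auto simp: L2_inner_def)

lemma L2_norm_sq: "(L2_norm f)\<^sup>2 = L2_inner f f"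
  using L2_inner_self_nonneg[of f] by (simp add: L2_norm_def L2_inner_def power2_eq_square)

lemma L2_inner_self_diff:
  assumes "f \<in> L2" "g \<in> L2"
  shows "L2_inner (\<lambda>t. f t - g t) (\<lambda>t. f t - g t) = L2_inner f f - 2 * L2_inner f g + L2_inner g g"
proof -
  have "(f t - g t) * (f t - g t) = f t * f t - 2 * (f t * g t) + g t * g t" for t
    by (simp add: algebra_simps)
  then show ?thesis
    using L2_times_integrable assms by (simp add: L2_inner_def)
qed

lemma L2_inner_mono:
  assumes "f1 \<in> L2" "g1 \<in> L2" "f2 \<in> L2" "g2 \<in> L2"
    and "\<And>t. 0 < t \<Longrightarrow> t < 1 \<Longrightarrow> f1 t * g1 t \<le> f2 t * g2 t"
  shows "L2_inner f1 g1 \<le> L2_inner f2 g2"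
  unfolding L2_inner_def using assms L2_times_integrable by (intro integral_mono) auto

lemma L2_inner_poly_poly: "L2_inner (poly p) (poly q) = L2_inner (poly 1) (poly (p * q))"
  by (simp add: L2_inner_def)

lemma integral_pderiv_unit_interval:
  "L2_inner (poly 1) (poly (pderiv p)) = poly p 1 - poly p 0"
proof -
  have i: "integrable unit_interval (\<lambda>t. poly (pderiv p) t)"
    using L2_times_integrable[of "poly 1" "poly (pderiv p)"] by auto
  have "((\<lambda>t. poly (pderiv p) t) has_integral (poly p 1 - poly p 0)) {0..1}"
    by (intro fundamental_theorem_of_calculus)
      (auto intro!: DERIV_subset[OF poly_DERIV] simp: has_real_derivative_iff_has_vector_derivative[symmetric])
  then have "integral {0..1} (poly (pderiv p)) = poly p 1 - poly p 0"
    by (rule integral_unique)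
  then show ?thesis using i
    by (simp add: L2_inner_def lebesgue_integral_eq_integral integral_open_interval_real)
qed

section \<open>Density of the polynomials in the space of square-integrable functions\<close>

lemma poly_dense_continuous:
  fixes f :: "real \<Rightarrow> real"
  assumes "continuous_on {0..1} f" "0 < e"
  shows "\<exists>p. \<forall>t\<in>{0..1}. \<bar>f t - poly p t\<bar> < e"
proof -
  obtain g where g: "real_polynomial_function g" "\<And>x. x \<in> {0..1} \<Longrightarrow> \<bar>f x - g x\<bar> < e"
    using Stone_Weierstrass_real_polynomial_function[of "{0..1::real}" f e] assms by auto
  obtain a n where a: "g = (\<lambda>x. \<Sum>i\<le>n. a i * x ^ i)"
    using g(1) unfolding real_polynomial_function_iff_sum by blast
  have "g x = poly (\<Sum>i\<le>n. monom (a i) i) x" for x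
    by (simp add: a poly_sum poly_monom)
  then show ?thesis using g(2) by metis
qed

text \<open>Clamping to [-M, M] changes nothing at a given point once M exceeds the value there, and
  the squared error never exceeds \<open>(y t)\<^sup>2\<close>, so dominated convergence applies.
  The clamped functions are bounded, which the approximation by continuous functions
  requires.\<close>

lemma L2_truncation_tendsto:
  assumes "y \<in> L2"
  shows "(\<lambda>M. L2_inner (\<lambda>t. y t - max (- real M) (min (real M) (y t)))
    (\<lambda>t. y t - max (- real M) (min (real M) (y t)))) \<longlonglongrightarrow> 0"
proof -
  have "(\<lambda>M. \<integral>t. (y t - max (- real M) (min (real M) (y t)))\<^sup>2 \<partial>unit_interval)
     \<longlonglongrightarrow> (\<integral>t. 0 \<partial>unit_interval)"
  proof (rule integral_dominated_convergence[where w="\<lambda>t. (y t)\<^sup>2"])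
    show "integrable unit_interval (\<lambda>t. (y t)\<^sup>2)" using assms by (simp add: L2_def)
    show "(\<lambda>t. (y t - max (- real M) (min (real M) (y t)))\<^sup>2) \<in> borel_measurable unit_interval" for M
      using assms by (auto simp: L2_def)
    show "AE t in unit_interval. (\<lambda>M. (y t - max (- real M) (min (real M) (y t)))\<^sup>2) \<longlonglongrightarrow> 0"
    proof (rule AE_I2, rule tendsto_eventually)
      fix t
      obtain N :: nat where "\<bar>y t\<bar> \<le> real N" using real_arch_simple by blast
      then show "\<forall>\<^sub>F M in sequentially. (y t - max (- real M) (min (real M) (y t)))\<^sup>2 = 0"
        by (intro eventually_sequentiallyI[of N]) (auto simp: max_def min_def)
    qed
    show "AE t in unit_interval. norm ((y t - max (- real M) (min (real M) (y t)))\<^sup>2) \<le> (y t)\<^sup>2" for M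
      by (rule AE_I2) (auto simp: abs_le_square_iff[symmetric])
  qed auto
  then show ?thesis by (simp add: L2_inner_def power2_eq_square)
qed

text \<open>Measurability supplies continuous \<open>g n\<close> converging to \<open>y\<close>
  almost everywhere, but no dominating function. Clamping \<open>g n\<close> by \<open>T M\<close>
  keeps continuity and provides the bound 2y^2 + 2M^2; the limit is then the clamped
  \<open>y\<close>, which is already close to \<open>y\<close> for the chosen M.\<close>

lemma continuous_dense_L2:
  assumes "y \<in> L2" "0 < e"
  shows "\<exists>g. continuous_on UNIV g \<and> L2_inner (\<lambda>t. y t - g t) (\<lambda>t. y t - g t) < e"
proof -
  interpret finite_measure unit_interval by (rule finite_measure_unit_interval)
  define T where "T M v = max (- real M) (min (real M) v)" for M :: nat and v :: real
  have T: "\<bar>T M v\<bar> \<le> real M" for M v by (auto simp: T_def)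
  have Tc: "continuous_on UNIV (T M)" for M
    unfolding T_def by (intro continuous_intros)
  obtain M where M: "L2_inner (\<lambda>t. y t - T M (y t)) (\<lambda>t. y t - T M (y t)) < e"
    using order_tendstoD(2)[OF L2_truncation_tendsto[OF assms(1)] assms(2)]
    unfolding T_def eventually_sequentially by blast
  have ym: "y \<in> borel_measurable unit_interval" using assms(1) by (simp add: L2_def)
  then have "y measurable_on {0<..<1}"
    using measurable_on_iff_borel_measurable[of "{0<..<1}" y] by simp
  then obtain N g where N: "negligible N" and g: "\<And>n. continuous_on UNIV (g n)"
    and lim: "\<And>x. x \<notin> N \<Longrightarrow> (\<lambda>n. g n x) \<longlonglongrightarrow> (if x \<in> {0<..<1} then y x else 0)"
    unfolding measurable_on_def by blast
  have AE: "AE t in unit_interval. (\<lambda>n. g n t) \<longlonglongrightarrow> y t"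
  proof -
    have "AE t in lebesgue. t \<notin> N"
      using N by (simp add: negligible_iff_null_sets AE_not_in)
    then have "AE t in lebesgue. t \<in> {0<..<1} \<longrightarrow> (\<lambda>n. g n t) \<longlonglongrightarrow> y t"
      by eventually_elim (use lim in force)
    then show ?thesis by (simp add: AE_restrict_space_iff)
  qed
  have Tg: "continuous_on UNIV (\<lambda>t. T M (g n t))" for n
    using continuous_on_compose2[OF Tc g] by auto
  have "(\<lambda>n. \<integral>t. (y t - T M (g n t))\<^sup>2 \<partial>unit_interval)
     \<longlonglongrightarrow> (\<integral>t. (y t - T M (y t))\<^sup>2 \<partial>unit_interval)"
  proof (rule integral_dominated_convergence[where w="\<lambda>t. 2 * (y t)\<^sup>2 + 2 * (real M)\<^sup>2"])
    show "integrable unit_interval (\<lambda>t. 2 * (y t)\<^sup>2 + 2 * (real M)\<^sup>2)"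
      using assms(1) by (auto simp: L2_def)
    show "(\<lambda>t. (y t - T M (g n t))\<^sup>2) \<in> borel_measurable unit_interval" for n
    proof -
      have "(\<lambda>t. T M (g n t)) \<in> borel_measurable unit_interval"
        by (intro continuous_imp_measurable_on_sets_lebesgue continuous_on_subset[OF Tg]) auto
      then show ?thesis using ym by simp
    qed
    show "AE t in unit_interval. (\<lambda>n. (y t - T M (g n t))\<^sup>2) \<longlonglongrightarrow> (y t - T M (y t))\<^sup>2"
      using AE unfolding T_def by eventually_elim (intro tendsto_intros)
    show "AE t in unit_interval. norm ((y t - T M (g n t))\<^sup>2) \<le> 2 * (y t)\<^sup>2 + 2 * (real M)\<^sup>2" for n
    proof (rule AE_I2)
      fix t
      have "(T M (g n t))\<^sup>2 \<le> (real M)\<^sup>2"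
        using T[of M "g n t"] by (simp add: abs_le_square_iff[symmetric])
      moreover have "(a - b)\<^sup>2 \<le> 2 * a\<^sup>2 + 2 * b\<^sup>2" for a b :: real
        using zero_le_power2[of "a + b"] by (simp add: power2_eq_square algebra_simps)
      ultimately show "norm ((y t - T M (g n t))\<^sup>2) \<le> 2 * (y t)\<^sup>2 + 2 * (real M)\<^sup>2"
        by (smt (verit) real_norm_def zero_le_power2)
    qed
  qed (use ym in \<open>auto simp: T_def\<close>)
  then have "\<forall>\<^sub>F n in sequentially. (\<integral>t. (y t - T M (g n t))\<^sup>2 \<partial>unit_interval) < e"
    by (rule order_tendstoD) (use M in \<open>simp add: L2_inner_def power2_eq_square\<close>)
  then obtain n where "(\<integral>t. (y t - T M (g n t))\<^sup>2 \<partial>unit_interval) < e"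
    by (auto simp: eventually_sequentially)
  then show ?thesis using Tg by (auto simp: L2_inner_def power2_eq_square)
qed

lemma L2_inner_self_le_sum:
  assumes "f \<in> L2" "g \<in> L2"
  shows "L2_inner (\<lambda>t. f t + g t) (\<lambda>t. f t + g t) \<le> 2 * L2_inner f f + 2 * L2_inner g g"
proof -
  have "(f t + g t) * (f t + g t) = f t * f t + 2 * (f t * g t) + g t * g t" for t
    by (simp add: algebra_simps)
  then have "L2_inner (\<lambda>t. f t + g t) (\<lambda>t. f t + g t)
      = L2_inner f f + 2 * L2_inner f g + L2_inner g g"
    using L2_times_integrable assms by (simp add: L2_inner_def)
  then show ?thesis
    using L2_inner_self_diff[OF assms] L2_inner_self_nonneg[of "\<lambda>t. f t - g t"] by linarith
qed

lemma poly_dense_L2: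
  assumes "y \<in> L2" "0 < e"
  shows "\<exists>p. L2_inner (\<lambda>t. y t - poly p t) (\<lambda>t. y t - poly p t) < e"
proof -
  obtain g where g: "continuous_on UNIV g" "L2_inner (\<lambda>t. y t - g t) (\<lambda>t. y t - g t) < e / 4"
    using continuous_dense_L2[of y "e / 4"] assms by auto
  define d where "d = sqrt (e / 4)"
  have gc: "continuous_on {0..1} g" using g(1) continuous_on_subset by blast
  obtain p where p: "\<forall>t\<in>{0..1}. \<bar>g t - poly p t\<bar> < d"
    using poly_dense_continuous[OF gc, of d] assms(2) by (auto simp: d_def)
  have gL: "g \<in> L2" using gc by (rule continuous_bounded_L2)
  have c: "(\<lambda>t. d) \<in> L2" by (intro continuous_bounded_L2 continuous_intros)
  have "L2_inner (\<lambda>t. g t - poly p t) (\<lambda>t. g t - poly p t) \<le> L2_inner (\<lambda>t. d) (\<lambda>t. d)"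
  proof (intro L2_inner_mono L2_diff gL poly_L2 c)
    show "(g t - poly p t) * (g t - poly p t) \<le> d * d" if "0 < t" "t < 1" for t
    proof -
      have "\<bar>g t - poly p t\<bar> < d" using p that by simp
      then have "\<bar>g t - poly p t\<bar> \<le> \<bar>d\<bar>" by linarith
      then show ?thesis by (simp add: abs_le_square_iff power2_eq_square)
    qed
  qed
  also have "\<dots> = e / 4"
    using integral_power_unit_interval[of 0] assms(2) by (simp add: L2_inner_def d_def)
  finally have "L2_inner (\<lambda>t. g t - poly p t) (\<lambda>t. g t - poly p t) \<le> e / 4" .
  moreover have "L2_inner (\<lambda>t. (y t - g t) + (g t - poly p t)) (\<lambda>t. (y t - g t) + (g t - poly p t))
     \<le> 2 * L2_inner (\<lambda>t. y t - g t) (\<lambda>t. y t - g t)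
       + 2 * L2_inner (\<lambda>t. g t - poly p t) (\<lambda>t. g t - poly p t)"
    by (intro L2_inner_self_le_sum L2_diff gL poly_L2 assms)
  ultimately have "L2_inner (\<lambda>t. y t - poly p t) (\<lambda>t. y t - poly p t) < e"
    using g(2) by simp
  then show ?thesis ..
qed

section \<open>Legendre polynomials and best approximation\<close>

text \<open>Coefficients of the Legendre polynomials shifted to $[0,1]$ and normalised to the value 1 at 0.\<close>

definition legendre_coeff :: "nat \<Rightarrow> nat \<Rightarrow> real" where
  "legendre_coeff m k = (-1) ^ k * real (m choose k) * real (m + k choose k)"

definition legendre :: "nat \<Rightarrow> real poly" where
  "legendre m = (\<Sum>k\<le>m. monom (legendre_coeff m k) k)"

definition parabola :: "real poly" where
  "parabola = [:0, 1, -1:]"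

lemma poly_parabola: "poly parabola t = t * (1 - t)"
  by (simp add: parabola_def algebra_simps)

definition legendre_op :: "real poly \<Rightarrow> real poly" where
  "legendre_op p = - pderiv (parabola * pderiv p)"

definition legendre_sq :: "nat \<Rightarrow> real" where
  "legendre_sq m = L2_inner (poly (legendre m)) (poly (legendre m))"

lemma legendre_coeff_eq_0: "m < k \<Longrightarrow> legendre_coeff m k = 0"
  by (simp add: legendre_coeff_def)

lemma legendre_coeff_0 [simp]: "legendre_coeff m 0 = 1"
  by (simp add: legendre_coeff_def)

lemma coeff_legendre: "coeff (legendre m) k = legendre_coeff m k"
  by (auto simp: legendre_def coeff_sum legendre_coeff_eq_0)

lemma degree_legendre_le: "degree (legendre m) \<le> m"
  by (rule degree_le) (simp add: coeff_legendre legendre_coeff_eq_0)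

text \<open>The two absorption identities (k+1) C(m,k+1) = (m-k) C(m,k) and (k+1) C(m+k+1,k+1) =
  (m+k+1) C(m+k,k) are multiplied, and (m-k)(m+k+1) = m(m+1) - k(k+1). This recurrence is the
  eigenvalue equation of \<open>legendre_op\<close> read off coefficient by coefficient.\<close>

lemma legendre_coeff_Suc:
  "(real k + 1)\<^sup>2 * legendre_coeff m (Suc k)
    = (real k * (real k + 1) - real m * (real m + 1)) * legendre_coeff m k"
proof -
  have "(k + 1) * (m choose (k + 1)) = (m - k) * (m choose k)"
    by (metis Suc_eq_plus1 binomial_absorb_comp binomial_absorption mult.commute)
  then have 1: "(real k + 1) * real (m choose Suc k) = (real m - real k) * real (m choose k)"
  proof (cases "k \<le> m")
    case True
    with \<open>(k + 1) * _ = _\<close> have "real (k + 1) * real (m choose (k + 1)) = real (m - k) * real (m choose k)"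
      by (metis of_nat_mult)
    with True show ?thesis by (simp add: of_nat_diff add.commute)
  qed (simp add: binomial_eq_0)
  have "Suc k * (Suc (m + k) choose Suc k) = Suc (m + k) * (m + k choose k)"
    using Suc_times_binomial_eq[of "m + k" k] by (simp only: mult.commute)
  then have "real (Suc k) * real (Suc (m + k) choose Suc k) = real (Suc (m + k)) * real (m + k choose k)"
    by (metis of_nat_mult)
  then have 2: "(real k + 1) * real (m + Suc k choose Suc k) = (real m + real k + 1) * real (m + k choose k)"
    by (simp add: add_ac)
  have "(real k + 1)\<^sup>2 * legendre_coeff m (Suc k)
     = - ((-1) ^ k * ((real k + 1) * real (m choose Suc k)) * ((real k + 1) * real (m + Suc k choose Suc k)))"
    by (simp only: legendre_coeff_def power2_eq_square power_Suc) (simp only: mult_ac mult_minus_left mult_1_left mult_minus_right)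
  also have "\<dots> = (real k * (real k + 1) - real m * (real m + 1)) * legendre_coeff m k"
    unfolding 1 2 legendre_coeff_def by (simp add: algebra_simps)
  finally show ?thesis .
qed

lemma legendre_op_legendre: "legendre_op (legendre m) = smult (real m * (real m + 1)) (legendre m)"
proof (rule poly_eqI)
  fix k
  have *: "parabola * q = pCons 0 (q - pCons 0 q)" for q
    by (simp add: parabola_def)
  have "coeff (legendre_op p) k = real k * (real k + 1) * coeff p k - (real k + 1)\<^sup>2 * coeff p (Suc k)" for p
    by (cases k) (simp_all add: legendre_op_def * coeff_pderiv coeff_pCons power2_eq_square algebra_simps)
  then have "coeff (legendre_op (legendre m)) k
      = real k * (real k + 1) * legendre_coeff m k - (real k + 1)\<^sup>2 * legendre_coeff m (Suc k)"
    by (simp only: coeff_legendre)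
  then show "coeff (legendre_op (legendre m)) k = coeff (smult (real m * (real m + 1)) (legendre m)) k"
    by (simp only: legendre_coeff_Suc coeff_smult coeff_legendre) (simp add: algebra_simps)
qed

lemma legendre_op_sum:
  "legendre_op (\<Sum>i\<in>I. smult (c i) (p i)) = (\<Sum>i\<in>I. smult (c i) (legendre_op (p i)))"
  by (induction I rule: infinite_finite_induct)
    (simp_all add: legendre_op_def pderiv_add pderiv_smult distrib_left)

text \<open>Integration by parts; the boundary terms carry the factor t(1-t) and vanish. The
  right-hand side is symmetric in \<open>p\<close> and \<open>q\<close>, which gives
  self-adjointness, and for \<open>p = q\<close> it is the weighted energy of the
  derivative.\<close>

lemma legendre_op_inner:
  "L2_inner (poly (legendre_op p)) (poly q) = L2_inner (poly 1) (poly (parabola * (pderiv p * pderiv q)))"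
proof -
  have "L2_inner (poly 1) (poly (pderiv (parabola * pderiv p * q))) = 0"
    unfolding integral_pderiv_unit_interval by (simp add: poly_parabola)
  moreover have "pderiv (parabola * pderiv p * q)
     = parabola * (pderiv p * pderiv q) - legendre_op p * q"
    by (simp only: legendre_op_def pderiv_mult[of "parabola * pderiv p"]) (simp add: algebra_simps)
  ultimately show ?thesis
    using L2_inner_poly_diff[OF poly_L2, of 1] L2_inner_poly_poly[of "legendre_op p" q] by simp
qed

text \<open>Eigenvectors of a symmetric operator for different eigenvalues: i(i+1) = j(j+1) forces i
  = j, since the difference factors as (i-j)(i+j+1).\<close>

lemma legendre_orthogonal:
  assumes "i \<noteq> j"
  shows "L2_inner (poly (legendre i)) (poly (legendre j)) = 0"
proof -
  have "L2_inner (poly (legendre_op (legendre i))) (poly (legendre j))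
      = L2_inner (poly (legendre_op (legendre j))) (poly (legendre i))"
    by (simp add: legendre_op_inner mult.commute[of "pderiv (legendre i)"])
  then have "real i * (real i + 1) * L2_inner (poly (legendre i)) (poly (legendre j))
      = real j * (real j + 1) * L2_inner (poly (legendre i)) (poly (legendre j))"
    by (simp add: legendre_op_legendre L2_inner_poly_smult L2_inner_commute[of "poly (smult _ _)"]
        L2_inner_commute[of "poly (legendre j)"])
  moreover have "real i * (real i + 1) \<noteq> real j * (real j + 1)"
  proof
    assume "real i * (real i + 1) = real j * (real j + 1)"
    then have "(real i - real j) * (real i + real j + 1) = 0" by (simp add: algebra_simps)
    then show False using assms by (auto simp: add_eq_0_iff)
  qed
  ultimately show ?thesis by simp
qed

text \<open>Bounding C(m+k,k) by 2^(m+k) leaves 2^m times the binomial expansion of (2+1)^m.\<close>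

lemma sum_abs_legendre_coeff_le: "(\<Sum>k\<le>m. \<bar>legendre_coeff m k\<bar>) \<le> 6 ^ m"
proof -
  have "(\<Sum>k\<le>m. \<bar>legendre_coeff m k\<bar>) \<le> (\<Sum>k\<le>m. real (m choose k) * 2 ^ (m + k))"
  proof (rule sum_mono)
    fix k
    have "m + k choose k \<le> 2 ^ (m + k)" by (rule binomial_le_pow2)
    then have "real (m + k choose k) \<le> 2 ^ (m + k)"
      by (metis of_nat_le_iff of_nat_numeral of_nat_power)
    then show "\<bar>legendre_coeff m k\<bar> \<le> real (m choose k) * 2 ^ (m + k)"
      by (simp add: legendre_coeff_def abs_mult mult_left_mono)
  qed
  also have "\<dots> = 2 ^ m * (\<Sum>k\<le>m. real (m choose k) * 2 ^ k * 1 ^ (m - k))"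
    by (simp add: sum_distrib_left power_add mult_ac)
  also have "\<dots> = 2 ^ m * (2 + 1) ^ m"
    by (subst binomial_ring) simp
  also have "\<dots> = 6 ^ m" by (simp add: power_mult_distrib[symmetric])
  finally show ?thesis .
qed

lemma legendre_near_0:
  assumes "0 \<le> t" "t \<le> 1"
  shows "\<bar>poly (legendre m) t - 1\<bar> \<le> 6 ^ m * t"
proof -
  have "poly (legendre m) t = (\<Sum>k\<le>m. legendre_coeff m k * t ^ k)"
    by (simp add: legendre_def poly_sum poly_monom)
  also have "\<dots> = 1 + (\<Sum>k\<in>{..m} - {0}. legendre_coeff m k * t ^ k)"
    by (subst sum.remove[of _ 0]) auto
  finally have "\<bar>poly (legendre m) t - 1\<bar> = \<bar>\<Sum>k\<in>{..m} - {0}. legendre_coeff m k * t ^ k\<bar>" by simp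
  also have "\<dots> \<le> (\<Sum>k\<in>{..m} - {0}. \<bar>legendre_coeff m k\<bar> * t)"
  proof (rule order_trans[OF sum_abs], rule sum_mono)
    fix k assume "k \<in> {..m} - {0}"
    then have "t ^ k \<le> t ^ 1" using assms by (intro power_decreasing) auto
    then show "\<bar>legendre_coeff m k * t ^ k\<bar> \<le> \<bar>legendre_coeff m k\<bar> * t"
      using assms by (simp add: abs_mult mult_left_mono)
  qed
  also have "\<dots> \<le> (\<Sum>k\<le>m. \<bar>legendre_coeff m k\<bar> * t)"
    using assms by (intro sum_mono2) auto
  also have "\<dots> \<le> 6 ^ m * t"
    unfolding sum_distrib_right[symmetric]
    by (intro mult_right_mono sum_abs_legendre_coeff_le assms)
  finally show ?thesis .
qed

text \<open>A crude bound suffices: \<open>legendre m\<close> is at least \<open>1 / 2\<close> on an interval of length \<open>1 / (2 * 6 ^ m)\<close>.\<close>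

lemma legendre_sq_ge: "1 / (8 * 6 ^ m) \<le> legendre_sq m"
proof -
  define a :: real where "a = 1 / (2 * 6 ^ m)"
  define g :: "real \<Rightarrow> real" where "g = (\<lambda>t. indicator {0<..<a} t / 2)"
  have one: "(1::real) \<le> 6 ^ m" by simp
  then have "(1::real) < 2 * 6 ^ m" by linarith
  then have a: "0 < a" "a < 1" by (simp_all add: a_def)
  have "indicat_real {0<..<a} \<in> borel_measurable unit_interval"
    using a by (intro borel_measurable_indicator) (auto simp: sets_restrict_space_iff)
  then have "g \<in> borel_measurable unit_interval"
    unfolding g_def by (rule borel_measurable_divide) simp
  then have gL: "g \<in> L2" by (rule bounded_measurable_L2[of _ 1]) (auto simp: g_def indicator_def)
  have "(\<integral>t. indicator {0<..<a} t \<partial>unit_interval) = measure unit_interval {0<..<a}"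
    using a by (simp add: Int_absorb2)
  also have "\<dots> = a"
    using a by (subst measure_restrict_space) auto
  finally have "(\<integral>t. indicator {0<..<a} t \<partial>unit_interval) = a" .
  moreover have "g t * g t = indicator {0<..<a} t / 4" for t by (simp add: g_def indicator_def)
  ultimately have "a / 4 = L2_inner g g"
    by (simp only: L2_inner_def Bochner_Integration.integral_divide_zero)
  also have "\<dots> \<le> legendre_sq m"
    unfolding legendre_sq_def
  proof (intro L2_inner_mono gL poly_L2)
    fix t :: real assume t: "0 < t" "t < 1"
    show "g t * g t \<le> poly (legendre m) t * poly (legendre m) t"
    proof (cases "t < a")
      case True
      then have "6 ^ m * t < 1 / 2" by (simp add: a_def field_simps)
      then have "1 / 2 \<le> poly (legendre m) t" using legendre_near_0[of t m] t by linarith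
      then have "(1 / 2) * (1 / 2) \<le> poly (legendre m) t * poly (legendre m) t"
        by (intro mult_mono) auto
      then show ?thesis using True t by (simp add: g_def)
    qed (simp add: g_def)
  qed
  finally show ?thesis by (simp add: a_def)
qed

lemma legendre_sq_pos: "0 < legendre_sq m"
  using legendre_sq_ge[of m] by (rule less_le_trans[rotated]) simp

text \<open>\<open>legendre m\<close> has degree exactly \<open>m\<close>, since its top coefficient
  is a signed product of nonzero binomials. Hence a suitable multiple of it removes the leading term
  and the induction lowers the degree.\<close>

lemma orthogonal_poly_degree_le:
  assumes "f \<in> L2" "\<And>m. m \<le> n \<Longrightarrow> L2_inner f (poly (legendre m)) = 0" "degree p \<le> n"
  shows "L2_inner f (poly p) = 0"
  using assms(2,3)
proof (induction n arbitrary: p)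
  case 0
  then obtain c where "p = [:c:]" using degree_eq_zeroE by blast
  then have "p = smult c (legendre 0)" by (simp add: legendre_def monom_0)
  then show ?case using 0(1)[of 0] by (simp only: L2_inner_poly_smult)
next
  case (Suc n)
  define c where "c = coeff p (Suc n) / legendre_coeff (Suc n) (Suc n)"
  define q where "q = p - smult c (legendre (Suc n))"
  have nz: "legendre_coeff (Suc n) (Suc n) \<noteq> 0"
    by (simp add: legendre_coeff_def del: binomial_Suc_Suc)
  have "degree q \<le> n"
  proof (rule degree_le, intro allI impI)
    fix i assume "n < i"
    show "coeff q i = 0"
    proof (cases "i = Suc n")
      case False
      then have "Suc n < i" using \<open>n < i\<close> by simp
      moreover from this have "coeff p i = 0" using Suc.prems(2) by (simp add: coeff_eq_0)
      ultimately show ?thesis by (simp add: q_def coeff_legendre legendre_coeff_eq_0)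
    qed (use nz in \<open>simp add: q_def c_def coeff_legendre\<close>)
  qed
  then have "L2_inner f (poly q) = 0" using Suc by simp
  then show ?case
    using Suc.prems(1)[of "Suc n"] assms(1)
    by (simp add: q_def L2_inner_poly_diff L2_inner_poly_smult del: poly_diff poly_smult)
qed

section \<open>Orthogonal projection onto the polynomials of bounded degree\<close>

definition legendre_fourier :: "(real \<Rightarrow> real) \<Rightarrow> nat \<Rightarrow> real" where
  "legendre_fourier y m = L2_inner y (poly (legendre m)) / legendre_sq m"

definition legendre_proj :: "nat \<Rightarrow> (real \<Rightarrow> real) \<Rightarrow> real poly" where
  "legendre_proj n y = (\<Sum>m\<le>n. smult (legendre_fourier y m) (legendre m))"

lemma L2_inner_legendre: "L2_inner y (poly (legendre m)) = legendre_fourier y m * legendre_sq m"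
  using legendre_sq_pos[of m] by (simp add: legendre_fourier_def)

lemma degree_legendre_proj_le: "degree (legendre_proj n y) \<le> n"
  unfolding legendre_proj_def
  by (intro degree_sum_le) (auto intro: order_trans[OF degree_smult_le] order_trans[OF degree_legendre_le])

lemma legendre_proj_residual_orthogonal:
  assumes "y \<in> L2" "degree p \<le> n"
  shows "L2_inner (\<lambda>t. y t - poly (legendre_proj n y) t) (poly p) = 0"
proof (rule orthogonal_poly_degree_le[OF _ _ assms(2)])
  fix m assume "m \<le> n"
  have "L2_inner (poly (legendre m)) (poly (legendre_proj n y))
      = (\<Sum>i\<le>n. legendre_fourier y i * L2_inner (poly (legendre m)) (poly (legendre i)))"
    by (simp only: legendre_proj_def L2_inner_poly_sum[OF poly_L2] L2_inner_poly_smult)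
  also have "\<dots> = (\<Sum>i\<le>n. if i = m then legendre_fourier y m * legendre_sq m else 0)"
    by (intro sum.cong) (auto simp: legendre_orthogonal legendre_sq_def)
  also have "\<dots> = L2_inner y (poly (legendre m))"
    using \<open>m \<le> n\<close> by (simp add: L2_inner_legendre)
  finally show "L2_inner (\<lambda>t. y t - poly (legendre_proj n y) t) (poly (legendre m)) = 0"
    using assms(1) by (simp add: L2_inner_diff_left poly_L2 L2_inner_commute[of "poly (legendre_proj n y)"])
qed (auto intro: assms)

lemma L2_inner_legendre_proj:
  assumes "y \<in> L2"
  shows "L2_inner y (poly (legendre_proj n y)) = (\<Sum>m\<le>n. (legendre_fourier y m)\<^sup>2 * legendre_sq m)"
  unfolding legendre_proj_def
  by (simp only: L2_inner_poly_sum[OF assms] L2_inner_poly_smult)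
    (simp add: L2_inner_legendre power2_eq_square mult.assoc)

lemma legendre_proj_self_inner:
  assumes "y \<in> L2"
  shows "L2_inner (poly (legendre_proj n y)) (poly (legendre_proj n y))
    = (\<Sum>m\<le>n. (legendre_fourier y m)\<^sup>2 * legendre_sq m)"
  using legendre_proj_residual_orthogonal[OF assms degree_legendre_proj_le]
    L2_inner_legendre_proj[OF assms] assms
  by (simp add: L2_inner_diff_left poly_L2)

text \<open>The squared distance in $L^2(0,1)$ from \<open>y\<close> to the polynomials of degree at most \<open>n\<close>.\<close>

definition legendre_error :: "nat \<Rightarrow> (real \<Rightarrow> real) \<Rightarrow> real" where
  "legendre_error n y = L2_inner y y - (\<Sum>m\<le>n. (legendre_fourier y m)\<^sup>2 * legendre_sq m)"

lemma legendre_error_eq: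
  assumes "y \<in> L2"
  shows "legendre_error n y =
    L2_inner (\<lambda>t. y t - poly (legendre_proj n y) t) (\<lambda>t. y t - poly (legendre_proj n y) t)"
  using assms by (simp add: legendre_error_def L2_inner_self_diff poly_L2 legendre_proj_self_inner
      L2_inner_legendre_proj)

text \<open>Pythagoras: \<open>y - p\<close> is the residual of the projection minus a polynomial of
  degree at most \<open>n\<close>, and the two are orthogonal.\<close>

lemma legendre_error_le:
  assumes "y \<in> L2" "degree p \<le> n"
  shows "legendre_error n y \<le> L2_inner (\<lambda>t. y t - poly p t) (\<lambda>t. y t - poly p t)"
proof -
  define d where "d = (\<lambda>t. y t - poly (legendre_proj n y) t)"
  define q where "q = p - legendre_proj n y"
  have "degree q \<le> n"
    unfolding q_def by (intro degree_diff_le assms degree_legendre_proj_le)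
  then have "L2_inner d (poly q) = 0"
    unfolding d_def by (rule legendre_proj_residual_orthogonal[OF assms(1)])
  then have "L2_inner (\<lambda>t. d t - poly q t) (\<lambda>t. d t - poly q t)
      = L2_inner d d + L2_inner (poly q) (poly q)"
    using assms by (subst L2_inner_self_diff) (auto simp: d_def)
  moreover have "L2_inner d d = legendre_error n y"
    using assms by (simp add: d_def legendre_error_eq)
  moreover have "(\<lambda>t. d t - poly q t) = (\<lambda>t. y t - poly p t)"
    by (auto simp: d_def q_def)
  ultimately show ?thesis using L2_inner_self_nonneg[of "poly q"] by simp
qed

section \<open>Decay of the distance to polynomials under differentiation\<close>

text \<open>
  \<open>r\<close> acts as the derivative of \<open>y\<close> against all polynomials that vanish at both endpoints. This is
  what the Legendre argument needs, and it avoids identifying \<open>y\<close> with a primitive of \<open>r\<close>.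
\<close>

definition has_poly_deriv :: "(real \<Rightarrow> real) \<Rightarrow> (real \<Rightarrow> real) \<Rightarrow> bool" where
  "has_poly_deriv y r \<longleftrightarrow>
     (\<forall>s. L2_inner y (poly (pderiv (parabola * s))) = - L2_inner r (poly (parabola * s)))"

text \<open>
  With $w=t(1-t)$ and $z$ the part of the expansion of $y$ in the degrees $n+1,\dots,N$, the energy
  $D=\int w z'^2$ equals $\int r\,w z'$. As $w\le 1/4$, this gives $D\le\|r\|^2/4$, while
  $D\ge(n+1)^2\|z\|^2$.
\<close>

lemma legendre_error_deriv_le:
  assumes y: "y \<in> L2" and r: "r \<in> L2" and d: "has_poly_deriv y r"
  shows "legendre_error n y \<le> L2_inner r r / (4 * (real n + 1)\<^sup>2)"
proof (rule field_le_epsilon)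
  fix e :: real assume "0 < e"
  obtain p where p: "L2_inner (\<lambda>t. y t - poly p t) (\<lambda>t. y t - poly p t) < e"
    using poly_dense_L2[OF y \<open>0 < e\<close>] by blast
  \<comment> \<open>By density of the polynomials, the components of \<open>y\<close> beyond degree
    \<open>N\<close> contribute less than \<open>e\<close>. Only finitely many degrees remain, and
    no infinite expansion is needed.\<close>
  define N where "N = max n (degree p)"
  have "legendre_error N y < e"
    using legendre_error_le[OF y, of p N] p by (simp add: N_def)
  define b where "b m = (legendre_fourier y m)\<^sup>2 * legendre_sq m" for m
  define I where "I = {n<..N}"
  define z where "z = (\<Sum>m\<in>I. smult (legendre_fourier y m) (legendre m))"
  have b0: "0 \<le> b m" for m using legendre_sq_pos[of m] by (simp add: b_def)
  define D where "D = (\<Sum>m\<in>I. real m * (real m + 1) * b m)"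
  have Az: "legendre_op z = (\<Sum>m\<in>I. smult (legendre_fourier y m * (real m * (real m + 1))) (legendre m))"
    unfolding z_def legendre_op_sum by (simp add: legendre_op_legendre)
  \<comment> \<open>Stated for general \<open>f\<close> because it is used twice: \<open>y\<close>
    and \<open>z\<close> have the same inner products with the Legendre polynomials of degrees in
    \<open>I\<close>. With \<open>f = z\<close> it identifies \<open>D\<close> as the energy, with
    \<open>f = y\<close> it brings in the derivative \<open>r\<close>.\<close>
  have "L2_inner (poly (legendre_op z)) f = D" if "f \<in> L2" 
    "\<And>m. m \<in> I \<Longrightarrow> L2_inner f (poly (legendre m)) = legendre_fourier y m * legendre_sq m" for f
    unfolding Az L2_inner_commute[of _ f]
    by (simp only: L2_inner_poly_sum[OF that(1)] L2_inner_poly_smult)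
      (simp add: that(2) D_def b_def power2_eq_square mult_ac)
  note Dz = this
  have Dy: "L2_inner y (poly (legendre_op z)) = D"
    using Dz[OF y] by (simp add: L2_inner_legendre L2_inner_commute)
  have "L2_inner (poly z) (poly (legendre m)) = legendre_fourier y m * legendre_sq m" if "m \<in> I" for m
  proof -
    have "L2_inner (poly z) (poly (legendre m))
       = (\<Sum>i\<in>I. legendre_fourier y i * L2_inner (poly (legendre m)) (poly (legendre i)))"
      unfolding z_def L2_inner_commute[of _ "poly (legendre m)"]
      by (simp only: L2_inner_poly_sum[OF poly_L2] L2_inner_poly_smult)
    also have "\<dots> = (\<Sum>i\<in>I. if i = m then legendre_fourier y m * legendre_sq m else 0)"
      by (intro sum.cong) (auto simp: legendre_orthogonal legendre_sq_def)
    finally show ?thesis using that by (simp add: I_def)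
  qed
  then have Dz': "L2_inner (poly 1) (poly (parabola * (pderiv z * pderiv z))) = D"
    using Dz[OF poly_L2] by (simp add: legendre_op_inner)
  define v where "v = parabola * pderiv z"
  have "D = - L2_inner y (poly (pderiv v))"
    unfolding Dy[symmetric] legendre_op_def v_def[symmetric]
    using L2_inner_poly_smult[of y "-1" "pderiv v"] by simp
  also have "\<dots> = L2_inner r (poly v)"
    using d unfolding has_poly_deriv_def v_def by simp
  finally have Dr: "D = L2_inner r (poly v)" .
  \<comment> \<open>The weight 4 is chosen to fit the bound D/4 for the squared norm of
    \<open>v\<close> proved below: together they read 8D <= |r|^2 + 4D, that is D <=
    |r|^2/4.\<close>
  have "0 \<le> L2_inner (\<lambda>t. r t - poly (smult 4 v) t) (\<lambda>t. r t - poly (smult 4 v) t)"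
    by (rule L2_inner_self_nonneg)
  also have "\<dots> = L2_inner r r - 8 * L2_inner r (poly v) + 16 * L2_inner (poly v) (poly v)"
    using r by (subst L2_inner_self_diff)
      (auto simp only: L2_inner_poly_smult L2_inner_commute[of "poly (smult 4 v)"] poly_L2)
  finally have Dle: "8 * D \<le> L2_inner r r + 16 * L2_inner (poly v) (poly v)" by (simp add: Dr)
  have "L2_inner (poly v) (poly v) \<le> L2_inner (poly [:1 / 4:]) (poly (parabola * (pderiv z * pderiv z)))"
  proof (intro L2_inner_mono poly_L2)
    fix t :: real assume t: "0 < t" "t < 1"
    define w where "w = t * (1 - t)"
    have "0 \<le> (t - 1 / 2)\<^sup>2" by simp
    then have "w \<le> 1 / 4" by (simp add: w_def power2_eq_square algebra_simps)
    moreover have "0 \<le> w" using t by (simp add: w_def)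
    ultimately have "w * w \<le> 1 / 4 * w" by (intro mult_right_mono)
    then have "w * w * (poly (pderiv z) t)\<^sup>2 \<le> 1 / 4 * w * (poly (pderiv z) t)\<^sup>2"
      by (rule mult_right_mono) simp
    then show "poly v t * poly v t
        \<le> poly [:1 / 4:] t * poly (parabola * (pderiv z * pderiv z)) t"
      by (simp add: v_def poly_parabola w_def power2_eq_square mult_ac)
  qed
  also have "\<dots> = D / 4"
    unfolding Dz'[symmetric] by (simp add: L2_inner_def)
  finally have D: "D \<le> L2_inner r r / 4" using Dle by simp
  have "(\<Sum>m\<in>I. b m) * (real n + 1)\<^sup>2 \<le> D"
    unfolding D_def sum_distrib_right
  proof (rule sum_mono)
    fix m assume "m \<in> I"
    then have "real n + 1 \<le> real m" by (simp add: I_def)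
    then have "(real n + 1) * (real n + 1) \<le> real m * (real m + 1)"
      by (intro mult_mono) auto
    then have "b m * ((real n + 1) * (real n + 1)) \<le> b m * (real m * (real m + 1))"
      by (intro mult_left_mono b0)
    then show "b m * (real n + 1)\<^sup>2 \<le> real m * (real m + 1) * b m"
      by (simp add: power2_eq_square mult_ac)
  qed
  with D have "(\<Sum>m\<in>I. b m) \<le> L2_inner r r / (4 * (real n + 1)\<^sup>2)"
    by (simp add: field_simps)
  moreover have "legendre_error n y = legendre_error N y + (\<Sum>m\<in>I. b m)"
  proof -
    have "{..N} = {..n} \<union> I" by (auto simp: I_def N_def)
    then have "(\<Sum>m\<le>N. b m) = (\<Sum>m\<le>n. b m) + (\<Sum>m\<in>I. b m)"
      by (simp only:) (rule sum.union_disjoint, auto simp: I_def)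
    then show ?thesis by (simp add: legendre_error_def b_def)
  qed
  ultimately show "legendre_error n y \<le> L2_inner r r / (4 * (real n + 1)\<^sup>2) + e"
    using \<open>legendre_error N y < e\<close> by linarith
qed

text \<open>Apply the previous estimate after subtracting from \<open>y\<close> a primitive of the best approximation of \<open>r\<close>.\<close>

lemma legendre_error_step:
  assumes y: "y \<in> L2" and r: "r \<in> L2" and d: "has_poly_deriv y r"
  shows "legendre_error (Suc n) y \<le> legendre_error n r / (real n + 1)\<^sup>2"
proof -
  define p where "p = legendre_proj n r"
  define P where "P = (\<Sum>i\<le>n. monom (coeff p i / (real i + 1)) (Suc i))"
  have "pderiv P = (\<Sum>i\<le>n. monom (coeff p i) i)"
    unfolding P_def by (induction n) (simp_all add: pderiv_add pderiv_monom add.commute)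
  also have "\<dots> = p"
    unfolding p_def by (rule poly_as_sum_of_monoms'[OF degree_legendre_proj_le])
  finally have P: "pderiv P = p" .
  have degP: "degree P \<le> Suc n"
    unfolding P_def by (intro degree_sum_le) (auto intro: order_trans[OF degree_monom_le])
  define f g where "f = (\<lambda>t. y t - poly P t)" and "g = (\<lambda>t. r t - poly p t)"
  have f: "f \<in> L2" and g: "g \<in> L2" using y r by (auto simp: f_def g_def)
  have "has_poly_deriv f g"
    unfolding has_poly_deriv_def
  proof
    fix s
    have "L2_inner (poly 1) (poly (pderiv (P * (parabola * s)))) = 0"
      unfolding integral_pderiv_unit_interval by (simp add: poly_parabola)
    then have "L2_inner (poly P) (poly (pderiv (parabola * s))) = - L2_inner (poly p) (poly (parabola * s))"
      unfolding L2_inner_poly_poly[of P] L2_inner_poly_poly[of p] pderiv_mult[of P] P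
      by (simp add: L2_inner_poly_add poly_L2 mult.commute[of p] del: poly_add)
    then show "L2_inner f (poly (pderiv (parabola * s))) = - L2_inner g (poly (parabola * s))"
      using d y r by (simp add: f_def g_def L2_inner_diff_left poly_L2 has_poly_deriv_def)
  qed
  then have "legendre_error n f \<le> L2_inner g g / (4 * (real n + 1)\<^sup>2)"
    by (rule legendre_error_deriv_le[OF f g])
  also have "\<dots> \<le> legendre_error n r / (real n + 1)\<^sup>2"
    unfolding legendre_error_eq[OF r] g_def p_def
    by (intro frac_le L2_inner_self_nonneg) auto
  finally have "legendre_error n f \<le> legendre_error n r / (real n + 1)\<^sup>2" .
  \<comment> \<open>\<open>P\<close> is a primitive and has one degree more than \<open>p\<close>,
    so a polynomial approximating \<open>f\<close> becomes one for \<open>y\<close> only in degree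
    \<open>Suc n\<close>.\<close>
  moreover have "legendre_error (Suc n) y \<le> legendre_error n f"
  proof -
    have "degree (P + legendre_proj n f) \<le> Suc n"
      using degree_legendre_proj_le[of n f] degP by (intro degree_add_le) auto
    from legendre_error_le[OF y this] show ?thesis
      unfolding legendre_error_eq[OF f] by (simp add: f_def diff_diff_eq)
  qed
  ultimately show ?thesis by linarith
qed

lemma legendre_error_le_inner: "legendre_error n y \<le> L2_inner y y"
  using legendre_sq_pos by (simp add: legendre_error_def sum_nonneg less_imp_le)

text \<open>Every derivative uses up one degree, so starting from degree \<open>n + k\<close> each
  step still has at least degree \<open>n\<close> at its disposal; its denominator is weakened to
  (n+1)^2 to obtain a single power. The induction replaces \<open>g\<close> by its shift, that is,
  it starts again from the first derivative.\<close>

lemma legendre_error_deriv_chain: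
  assumes "\<And>i. i \<le> k \<Longrightarrow> g i \<in> L2" "\<And>i. i < k \<Longrightarrow> has_poly_deriv (g i) (g (Suc i))"
  shows "legendre_error (n + k) (g 0) \<le> L2_inner (g k) (g k) / (real n + 1) ^ (2 * k)"
  using assms
proof (induction k arbitrary: g)
  case 0
  then show ?case by (simp add: legendre_error_le_inner)
next
  case (Suc k)
  have "legendre_error (n + k) (g (Suc 0)) \<le> L2_inner (g (Suc k)) (g (Suc k)) / (real n + 1) ^ (2 * k)"
    using Suc.IH[of "\<lambda>i. g (Suc i)"] Suc.prems by simp
  have "legendre_error (n + Suc k) (g 0) \<le> legendre_error (n + k) (g (Suc 0)) / (real (n + k) + 1)\<^sup>2"
    using Suc.prems legendre_error_step[of "g 0" "g (Suc 0)" "n + k"] by simp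
  also have "\<dots> \<le> legendre_error (n + k) (g (Suc 0)) / (real n + 1)\<^sup>2"
    using legendre_error_eq[of "g (Suc 0)"] L2_inner_self_nonneg Suc.prems(1)[of "Suc 0"]
    by (intro divide_left_mono power_mono) auto
  also have "\<dots> \<le> L2_inner (g (Suc k)) (g (Suc k)) / (real n + 1) ^ (2 * k) / (real n + 1)\<^sup>2"
    by (intro divide_right_mono) (fact, simp)
  also have "\<dots> = L2_inner (g (Suc k)) (g (Suc k)) / (real n + 1) ^ (2 * Suc k)"
    by (simp add: power2_eq_square)
  finally show ?case .
qed

section \<open>Control of the low-degree part by the moments\<close>

lemma legendre_fourier_moments_le:
  assumes x: "x \<in> L2" and le: "ell2_norm (hausdorff_moments x) \<le> \<delta>"
  shows "\<bar>L2_inner x (poly (legendre m))\<bar> \<le> \<delta> * 6 ^ m"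
proof -
  define a where "a = hausdorff_moments x"
  have sm: "summable (\<lambda>j. (a j)\<^sup>2)"
    using hausdorff_moments_in_ell2[OF x] by (simp add: ell2_def a_def)
  have a: "\<bar>a j\<bar> \<le> \<delta>" for j
  proof -
    have "(a j)\<^sup>2 \<le> (\<Sum>j. (a j)\<^sup>2)"
      using sum_le_suminf[OF sm, of "{j}"] by simp
    then have "\<bar>a j\<bar> \<le> sqrt (\<Sum>j. (a j)\<^sup>2)"
      using real_le_rsqrt by fastforce
    then show ?thesis using le by (simp add: ell2_norm_def a_def)
  qed
  have "L2_inner x (poly (legendre m)) = (\<Sum>k\<le>m. legendre_coeff m k * a k)"
  proof -
    have "L2_inner x (poly (monom c k)) = c * a k" for c k
      by (simp add: L2_inner_def a_def hausdorff_moments_def poly_monom mult_ac)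
    then show ?thesis by (simp only: legendre_def L2_inner_poly_sum[OF x])
  qed
  also have "\<bar>\<dots>\<bar> \<le> (\<Sum>k\<le>m. \<bar>legendre_coeff m k\<bar> * \<delta>)"
    by (rule order_trans[OF sum_abs]) (auto intro!: sum_mono mult_left_mono a simp: abs_mult)
  also have "\<dots> \<le> 6 ^ m * \<delta>"
    \<comment> \<open>That \<delta> is nonnegative is not assumed; it follows because \<delta>
      bounds the absolute value of the entry \<open>a 0\<close>.\<close>
    unfolding sum_distrib_right[symmetric]
    using a[of 0] by (intro mult_right_mono sum_abs_legendre_coeff_le) linarith
  finally show ?thesis by (simp add: mult.commute)
qed

text \<open>The component in degree m is c^2 divided by the squared norm of
  \<open>legendre m\<close>, with c^2 <= 36^m \<delta>^2 and inverse squared norm at most 8 * 6^m,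
  hence 8 * 216^m \<delta>^2. The geometric sum over m <= n stays below 9 * 216^n.\<close>

lemma L2_inner_le_moments:
  assumes x: "x \<in> L2" and le: "ell2_norm (hausdorff_moments x) \<le> \<delta>"
  shows "L2_inner x x \<le> legendre_error n x + 9 * 216 ^ n * \<delta>\<^sup>2"
proof -
  have "(\<Sum>m\<le>n. (legendre_fourier x m)\<^sup>2 * legendre_sq m) \<le> (\<Sum>m\<le>n. 8 * 216 ^ m * \<delta>\<^sup>2)"
  proof (rule sum_mono)
    fix m
    define N c where "N = legendre_sq m" and "c = L2_inner x (poly (legendre m))"
    have N: "0 < N" "1 / N \<le> 8 * 6 ^ m"
      using legendre_sq_pos[of m] legendre_sq_ge[of m] by (simp_all add: N_def field_simps)
    have "\<bar>c\<bar> \<le> \<delta> * 6 ^ m" unfolding c_def by (rule legendre_fourier_moments_le[OF assms])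
    then have "c\<^sup>2 \<le> (\<delta> * 6 ^ m)\<^sup>2" by (rule abs_le_square_iff[THEN iffD1, OF order_trans]) simp
    then have "c\<^sup>2 * (1 / N) \<le> (\<delta> * 6 ^ m)\<^sup>2 * (8 * 6 ^ m)"
      using N by (intro mult_mono) auto
    moreover have "(\<delta> * 6 ^ m)\<^sup>2 * (8 * 6 ^ m) = 8 * 216 ^ m * \<delta>\<^sup>2"
    proof -
      have "(216::real) ^ m = 6 ^ m * 6 ^ m * 6 ^ m" by (simp flip: power_mult_distrib)
      then show ?thesis by (simp add: power2_eq_square mult_ac)
    qed
    moreover have "(legendre_fourier x m)\<^sup>2 * legendre_sq m = c\<^sup>2 * (1 / N)"
      using N by (simp add: legendre_fourier_def c_def N_def power2_eq_square field_simps)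
    ultimately show "(legendre_fourier x m)\<^sup>2 * legendre_sq m \<le> 8 * 216 ^ m * \<delta>\<^sup>2" by simp
  qed
  also have "\<dots> = (\<Sum>m\<le>n. 8 * 216 ^ m) * \<delta>\<^sup>2" by (rule sum_distrib_right[symmetric])
  also have "(\<Sum>m\<le>n. 8 * 216 ^ m) \<le> (9 * 216 ^ n :: real)"
  proof (induction n)
    case (Suc n)
    have "(0::real) \<le> 216 ^ n" by simp
    moreover have "(\<Sum>m\<le>Suc n. 8 * 216 ^ m) = (\<Sum>m\<le>n. 8 * 216 ^ m) + 1728 * (216 ^ n :: real)"
      by simp
    moreover have "9 * 216 ^ Suc n = 1944 * (216 ^ n :: real)" by simp
    ultimately show ?case using Suc by linarith
  qed simp
  finally show ?thesis by (simp add: legendre_error_def mult_right_mono)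
qed

section \<open>Weak derivatives tested against polynomials\<close>

text \<open>\<open>flat j\<close> is smooth on the whole line; its restriction to $(0,\infty)$ is $u^{-j}e^{-1/u}$.\<close>

definition flat :: "nat \<Rightarrow> real \<Rightarrow> real" where
  "flat j u = (if 0 < u then exp (- 1 / u) / u ^ j else 0)"

lemma flat_nonneg: "0 \<le> flat j u"
  by (simp add: flat_def)

text \<open>From s <= exp s at s = 1/(nu) with n = j+2, raised to the power n, one gets exp(-1/u) <=
  (nu)^n; division by u^j leaves a square. The exponent 2 is what differentiability at 0
  requires.\<close>

lemma flat_le_square: "flat j u \<le> real (j + 2) ^ (j + 2) * u\<^sup>2"
proof (cases "0 < u")
  case True
  define n where "n = j + 2"
  have "1 / u / real n \<le> exp (1 / u / real n)"
    using exp_ge_add_one_self[of "1 / u / real n"] by linarith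
  then have "(1 / u / real n) ^ n \<le> exp (1 / u / real n) ^ n"
    using True by (intro power_mono) auto
  also have "\<dots> = exp (real n * (1 / u / real n))"
    by (rule exp_of_nat_mult[symmetric])
  also have "real n * (1 / u / real n) = 1 / u" by (simp add: n_def)
  finally have "exp (- (1 / u)) * (1 / u / real n) ^ n \<le> exp (- (1 / u)) * exp (1 / u)"
    by (intro mult_left_mono) auto
  then have "exp (- 1 / u) * (1 / u / real n) ^ n \<le> 1"
    by (simp flip: exp_add)
  then have "exp (- 1 / u) / (u * real n) ^ n \<le> 1"
    by (simp only: divide_divide_eq_left power_divide times_divide_eq_right power_one mult_1_right)
  then have "exp (- 1 / u) \<le> (u * real n) ^ n"
    using True by (simp add: n_def divide_le_eq)
  also have "\<dots> = real n ^ n * u\<^sup>2 * u ^ j"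
    unfolding power_mult_distrib by (simp add: n_def power_add power2_eq_square)
  finally show ?thesis
    using True by (simp add: flat_def n_def divide_le_eq)
qed (simp add: flat_def)

text \<open>Away from 0 this is calculus. At 0 the quadratic bound makes the difference quotient
  O(|h|), and the claimed derivative is 0 there by definition of \<open>flat\<close>.\<close>

lemma has_real_derivative_flat:
  "(flat j has_real_derivative (flat (j + 2) u - real j * flat (j + 1) u)) (at u)"
proof -
  consider "0 < u" | "u < 0" | "u = 0" by linarith
  then show ?thesis
  proof cases
    case 1
    have i: "(inverse has_real_derivative - (inverse u)\<^sup>2) (at u)"
      using DERIV_inverse[of u UNIV] 1 by (simp add: power2_eq_square)
    have "((\<lambda>u. exp (- inverse u)) has_real_derivative exp (- inverse u) * (inverse u)\<^sup>2) (at u)"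
      using DERIV_fun_exp[OF DERIV_minus[OF i]] by simp
    moreover have "((\<lambda>u. inverse u ^ j) has_real_derivative - (real j * inverse u ^ (j + 1))) (at u)"
      by (rule DERIV_cong[OF DERIV_power[OF i]]) (cases j; simp add: power2_eq_square)
    ultimately have "((\<lambda>u. exp (- inverse u) * inverse u ^ j) has_real_derivative
        (exp (- inverse u) * (inverse u)\<^sup>2 * inverse u ^ j + - (real j * inverse u ^ (j + 1)) * exp (- inverse u))) (at u)"
      by (rule DERIV_mult)
    moreover have e: "flat i x = exp (- inverse x) * inverse x ^ i" if "0 < x" for i x
      using that by (simp add: flat_def divide_inverse power_inverse)
    ultimately have "((\<lambda>u. exp (- inverse u) * inverse u ^ j) has_real_derivative
        (flat (j + 2) u - real j * flat (j + 1) u)) (at u)"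
      unfolding e[OF 1] by (simp only: power_add mult_ac) (simp add: mult_ac)
    then show ?thesis
      by (rule has_field_derivative_transform_within_open[where S="{0<..}"])
        (use 1 e in auto)
  next
    case 2
    have "((\<lambda>u. 0) has_real_derivative (flat (j + 2) u - real j * flat (j + 1) u)) (at u)"
      using 2 by (simp add: flat_def)
    then show ?thesis
      by (rule has_field_derivative_transform_within_open[where S="{..<0}"])
        (use 2 in \<open>auto simp: flat_def\<close>)
  next
    case 3
    define K where "K = real (j + 2) ^ (j + 2)"
    have "((\<lambda>h. (flat j (0 + h) - flat j 0) / h) \<longlongrightarrow> 0) (at 0)"
    proof (rule Lim_null_comparison)
      show "\<forall>\<^sub>F h in at 0. norm ((flat j (0 + h) - flat j 0) / h) \<le> K * \<bar>h\<bar>"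
      proof (rule always_eventually, rule allI)
        fix h
        show "norm ((flat j (0 + h) - flat j 0) / h) \<le> K * \<bar>h\<bar>"
        proof (cases "h = 0")
          case False
          have "flat j h \<le> K * \<bar>h\<bar> * \<bar>h\<bar>"
            using flat_le_square[of j h] by (simp add: K_def power2_eq_square mult.assoc)
          then show ?thesis using False flat_nonneg[of j h] by (simp add: flat_def[of j 0] divide_le_eq)
        qed simp
      qed
      have "((\<lambda>h. K * \<bar>h\<bar>) \<longlongrightarrow> K * \<bar>0\<bar>) (at 0)" by (intro tendsto_intros)
      then show "((\<lambda>h. K * \<bar>h\<bar>) \<longlongrightarrow> 0) (at 0)" by simp
    qed
    then show ?thesis using 3 by (simp add: DERIV_def flat_def)
  qed
qed

text \<open>A class of functions closed under differentiation, so that its members are smooth.\<close>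

inductive_set flat_span :: "real poly \<Rightarrow> (real \<Rightarrow> real) set" for v where
  base: "(\<lambda>t. poly p t * flat j (poly v t)) \<in> flat_span v"
| add: "f \<in> flat_span v \<Longrightarrow> g \<in> flat_span v \<Longrightarrow> (\<lambda>t. f t + g t) \<in> flat_span v"

text \<open>The derivative is arranged as a sum of three terms of the shape of the generators of
  \<open>flat_span\<close>, so that membership is immediate from its introduction rules.\<close>

lemma has_real_derivative_flat_poly:
  "((\<lambda>t. poly p t * flat j (poly v t)) has_real_derivative
    (poly (pderiv p) t * flat j (poly v t) + poly (p * pderiv v) t * flat (j + 2) (poly v t)
      + poly (smult (- real j) (p * pderiv v)) t * flat (j + 1) (poly v t))) (at t)"
  by (rule DERIV_cong[OF DERIV_mult[OF poly_DERIV DERIV_chain2[OF has_real_derivative_flat poly_DERIV]]])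
    (simp add: algebra_simps)

lemma flat_span_deriv:
  assumes "f \<in> flat_span v"
  shows "\<exists>f'\<in>flat_span v. \<forall>t. (f has_real_derivative f' t) (at t)"
  using assms
proof induction
  case (base p j)
  show ?case
    by (rule bexI, rule allI, rule has_real_derivative_flat_poly) (rule flat_span.base flat_span.add)+
next
  case (add f g)
  then obtain f' g' where "f' \<in> flat_span v" "g' \<in> flat_span v"
    "\<forall>t. (f has_real_derivative f' t) (at t)" "\<forall>t. (g has_real_derivative g' t) (at t)" by blast
  then show ?case
    by (intro bexI[of _ "\<lambda>t. f' t + g' t"] allI DERIV_add flat_span.add) auto
qed

lemma deriv_flat_span: "f \<in> flat_span v \<Longrightarrow> deriv f \<in> flat_span v"
proof -
  assume "f \<in> flat_span v"
  then obtain f' where "f' \<in> flat_span v" "\<forall>t. (f has_real_derivative f' t) (at t)"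
    using flat_span_deriv by blast
  moreover from this have "deriv f = f'" by (auto simp: DERIV_imp_deriv)
  ultimately show ?thesis by simp
qed

lemma flat_span_smooth:
  assumes "f \<in> flat_span v"
  shows "(deriv ^^ n) f differentiable (at x)"
proof -
  have "(deriv ^^ n) f \<in> flat_span v"
    using assms by (induction n) (auto intro: deriv_flat_span)
  then show ?thesis
    using flat_span_deriv real_differentiable_def by blast
qed

text \<open>
  \<open>cutoff s m\<close> is a test function that tends to $s\,t(1-t)$ as $m\to\infty$, with a derivative that
  converges boundedly: the factor \<open>cutoff_poly m\<close> compensates the steep slope of the flat function.
\<close>

definition cutoff_poly :: "nat \<Rightarrow> real poly" where
  "cutoff_poly m = smult (real m) parabola - 1"

definition cutoff :: "real poly \<Rightarrow> nat \<Rightarrow> real \<Rightarrow> real" where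
  "cutoff s m t = poly (smult (1 / real m) (s * cutoff_poly m)) t * flat 0 (poly (cutoff_poly m) t)"

lemma poly_cutoff_poly: "poly (cutoff_poly m) t = real m * (t * (1 - t)) - 1"
  by (simp add: cutoff_poly_def poly_parabola)

text \<open>Where \<open>cutoff_poly m\<close> is positive, 1/m < t(1-t) <= min(t, 1-t); elsewhere
  \<open>flat\<close> vanishes. For m = 1 the interval is empty and the function is zero.\<close>

lemma cutoff_test_function:
  assumes "0 < m"
  shows "test_function (cutoff s m)"
proof -
  have "cutoff s m \<in> flat_span (cutoff_poly m)"
    unfolding cutoff_def[abs_def] by (rule flat_span.base)
  moreover have "cutoff s m t = 0" if "t \<notin> {1 / real m..1 - 1 / real m}" for t
  proof -
    have "poly (cutoff_poly m) t \<le> 0"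
    proof (rule ccontr)
      assume "\<not> ?thesis"
      then have 1: "1 / real m < t * (1 - t)"
        using assms by (simp add: poly_cutoff_poly field_simps)
      moreover have "0 < 1 / real m" using assms by simp
      ultimately have "0 < t * (1 - t)" by linarith
      then have "0 < t" "t < 1" by (auto simp: zero_less_mult_iff)
      then have "t * (1 - t) \<le> t" "t * (1 - t) \<le> 1 - t"
        by (auto simp: mult_left_le_one_le mult_left_le)
      with 1 that show False by auto
    qed
    then show ?thesis by (simp add: cutoff_def flat_def)
  qed
  ultimately show ?thesis
    unfolding test_function_def
    by (intro conjI allI flat_span_smooth exI[of _ "1 / real m"] exI[of _ "1 - 1 / real m"])
      (use assms in auto)
qed

text \<open>The slope m of \<open>cutoff_poly m\<close> cancels against 1/m, and the remaining
  factor u turns \<open>flat 2 u\<close> into \<open>flat 1 u\<close>. Every term is therefore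
  bounded uniformly in m on the unit interval.\<close>

lemma deriv_cutoff:
  assumes "0 < m"
  shows "deriv (cutoff s m) t =
    poly (pderiv s) t * (poly (cutoff_poly m) t / real m * flat 0 (poly (cutoff_poly m) t))
    + poly s t * poly (pderiv parabola) t * flat 0 (poly (cutoff_poly m) t)
    + poly s t * poly (pderiv parabola) t * flat 1 (poly (cutoff_poly m) t)"
proof -
  have u: "u * flat 2 u = flat 1 u" for u by (simp add: flat_def power2_eq_square)
  have v': "poly (pderiv (cutoff_poly m)) t = real m * poly (pderiv parabola) t"
    by (simp add: cutoff_poly_def pderiv_diff pderiv_smult)
  have "(cutoff s m has_real_derivative
    (poly (pderiv s) t * (poly (cutoff_poly m) t / real m * flat 0 (poly (cutoff_poly m) t))
    + poly s t * poly (pderiv parabola) t * flat 0 (poly (cutoff_poly m) t)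
    + poly s t * poly (pderiv parabola) t * (poly (cutoff_poly m) t * flat 2 (poly (cutoff_poly m) t)))) (at t)"
    unfolding cutoff_def[abs_def]
    by (rule DERIV_cong[OF has_real_derivative_flat_poly])
      (use assms in \<open>simp add: pderiv_smult pderiv_mult v' field_simps flip: numeral_2_eq_2\<close>)
  then show ?thesis unfolding u by (rule DERIV_imp_deriv)
qed

lemma poly_bounded_unit_interval:
  fixes p :: "real poly"
  obtains K where "\<And>t. 0 < t \<Longrightarrow> t < 1 \<Longrightarrow> \<bar>poly p t\<bar> \<le> K" "0 \<le> K"
proof -
  have "compact (poly p ` {0..1})" by (intro compact_continuous_image continuous_intros compact_Icc)
  then obtain K where K: "\<forall>t\<in>{0..1}. \<bar>poly p t\<bar> \<le> K"
    using compact_imp_bounded bounded_iff by (metis imageI real_norm_def)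
  then have "\<bar>poly p 0\<bar> \<le> K" by (rule bspec) simp
  then have "0 \<le> K" by linarith
  with K show ?thesis by (intro that[of K]) auto
qed

lemma flat_0_tendsto: "filterlim f at_top F \<Longrightarrow> ((\<lambda>n. flat 0 (f n)) \<longlongrightarrow> 1) F"
proof -
  have "((\<lambda>u. exp (- 1 / u)) \<longlongrightarrow> exp 0) (at_top :: real filter)"
    by (rule tendsto_exp[OF real_tendsto_divide_at_top[OF tendsto_const filterlim_ident]])
  moreover have "\<forall>\<^sub>F u in at_top. exp (- 1 / u) = flat 0 u"
    using eventually_gt_at_top[of 0] by eventually_elim (simp add: flat_def)
  ultimately have "(flat 0 \<longlongrightarrow> exp 0) at_top" by (rule Lim_transform_eventually)
  then have "(flat 0 \<longlongrightarrow> 1) at_top" by simp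
  then show "filterlim f at_top F \<Longrightarrow> ((\<lambda>n. flat 0 (f n)) \<longlongrightarrow> 1) F"
    by (rule filterlim_compose)
qed

lemma flat_1_tendsto: "filterlim f at_top F \<Longrightarrow> ((\<lambda>n. flat 1 (f n)) \<longlongrightarrow> 0) F"
proof -
  have "((\<lambda>u. flat 0 u / u) \<longlongrightarrow> 0) (at_top :: real filter)"
    by (rule real_tendsto_divide_at_top[OF flat_0_tendsto[OF filterlim_ident] filterlim_ident])
  moreover have "flat 1 = (\<lambda>u. flat 0 u / u)" by (auto simp: flat_def)
  ultimately have "(flat 1 \<longlongrightarrow> 0) at_top" by (simp only:)
  then show "filterlim f at_top F \<Longrightarrow> ((\<lambda>n. flat 1 (f n)) \<longlongrightarrow> 0) F"
    by (rule filterlim_compose)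
qed

text \<open>The cutoffs are inserted into the weak derivative identity and both sides pass to the
  limit by dominated convergence. Of the three terms of the derivative, the first two tend to those
  of (t(1-t)s)' and the third, with \<open>flat 1\<close>, tends to 0.\<close>

lemma weak_deriv_imp_has_poly_deriv:
  assumes y: "y \<in> L2" and r: "r \<in> L2" and d: "has_weak_deriv 1 y r"
  shows "has_poly_deriv y r"
  unfolding has_poly_deriv_def
proof
  fix s :: "real poly"
  obtain A where A: "\<And>t. 0 < t \<Longrightarrow> t < 1 \<Longrightarrow> \<bar>poly s t\<bar> \<le> A" "0 \<le> A"
    using poly_bounded_unit_interval[of s] by blast
  obtain B where B: "\<And>t. 0 < t \<Longrightarrow> t < 1 \<Longrightarrow> \<bar>poly (pderiv s) t\<bar> \<le> B" "0 \<le> B"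
    using poly_bounded_unit_interval[of "pderiv s"] by blast
  define v where "v m t = poly (cutoff_poly (Suc m)) t" for m t
  have vtop: "filterlim (\<lambda>m. v m t) at_top sequentially" if "0 < t" "t < 1" for t
  proof -
    have "0 < t * (1 - t)" using that by simp
    then have "filterlim (\<lambda>m. -1 + t * (1 - t) * real (Suc m)) at_top sequentially"
      by (intro filterlim_tendsto_add_at_top[OF tendsto_const] filterlim_tendsto_pos_mult_at_top[OF tendsto_const]
           filterlim_compose[OF filterlim_real_sequentially filterlim_Suc])
    then show ?thesis by (simp add: v_def poly_cutoff_poly mult.commute)
  qed
  have vm: "(\<lambda>m. v m t / real (Suc m)) \<longlonglongrightarrow> t * (1 - t)" for t
  proof -
    have "(\<lambda>m. t * (1 - t) - inverse (real (Suc m))) \<longlonglongrightarrow> t * (1 - t) - 0"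
      by (intro tendsto_intros LIMSEQ_inverse_real_of_nat)
    then show ?thesis
      by (simp add: v_def poly_cutoff_poly diff_divide_distrib inverse_eq_divide del: of_nat_Suc)
  qed
  have vb: "v m t / real (Suc m) * flat 0 (v m t) \<le> 1"
    "0 \<le> v m t / real (Suc m) * flat 0 (v m t)" if "0 < t" "t < 1" for m t
  proof -
    have "v m t / real (Suc m) * flat 0 (v m t) \<le> 1 \<and> 0 \<le> v m t / real (Suc m) * flat 0 (v m t)"
    proof (cases "0 < v m t")
      case True
      have "t * (1 - t) \<le> 1 * 1" using that by (intro mult_mono) auto
      then have "real (Suc m) * (t * (1 - t)) \<le> real (Suc m) * 1" by (intro mult_left_mono) auto
      then have "real (Suc m) * (t * (1 - t)) \<le> real (Suc m)" by (simp only: mult_1_right)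
      then have "real (Suc m) * (t * (1 - t)) - 1 \<le> real (Suc m)" by (rule order_trans[rotated]) simp
      then have "v m t \<le> real (Suc m)" by (simp only: v_def poly_cutoff_poly)
      then have "v m t / real (Suc m) * flat 0 (v m t) \<le> 1 * 1"
        using True by (intro mult_mono) (auto simp: flat_def)
      then show ?thesis using True by (simp add: flat_nonneg)
    qed (simp add: flat_def)
    then show "v m t / real (Suc m) * flat 0 (v m t) \<le> 1"
      "0 \<le> v m t / real (Suc m) * flat 0 (v m t)" by auto
  qed
  have f0: "flat 0 u \<le> 1" for u by (simp add: flat_def)
  have f1: "flat 1 u \<le> 1" for u
  proof (cases "0 < u")
    case True
    have "1 / u \<le> exp (1 / u)" using exp_ge_add_one_self[of "1 / u"] by linarith
    then have "exp (- (1 / u)) * (1 / u) \<le> exp (- (1 / u)) * exp (1 / u)"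
      by (intro mult_left_mono) auto
    then show ?thesis using True by (simp add: flat_def flip: exp_add)
  qed (simp add: flat_def)
  define \<phi> where "\<phi> m = cutoff s (Suc m)" for m
  have \<phi>: "\<phi> m t = poly s t * (v m t / real (Suc m) * flat 0 (v m t))" for m t
    by (simp add: \<phi>_def cutoff_def v_def)
  have \<phi>': "deriv (\<phi> m) t = poly (pderiv s) t * (v m t / real (Suc m) * flat 0 (v m t))
    + poly s t * poly (pderiv parabola) t * flat 0 (v m t)
    + poly s t * poly (pderiv parabola) t * flat 1 (v m t)" for m t
    unfolding \<phi>_def v_def by (rule deriv_cutoff) simp
  have smooth: "\<phi> m differentiable (at t)" "deriv (\<phi> m) differentiable (at t)" for m t
    using cutoff_test_function[of "Suc m" s] unfolding \<phi>_def test_function_def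
    by (metis funpow_0 zero_less_Suc, metis funpow_0 funpow.simps(2) comp_apply zero_less_Suc)
  have "continuous_on {0<..<1} (\<phi> m)" "continuous_on {0<..<1} (deriv (\<phi> m))" for m
    using smooth by (meson continuous_at_imp_continuous_on differentiable_imp_continuous_within)+
  then have meas: "\<phi> m \<in> borel_measurable unit_interval" "deriv (\<phi> m) \<in> borel_measurable unit_interval" for m
    by (auto intro: continuous_imp_measurable_on_sets_lebesgue)
  have one: "(\<lambda>t. 1) \<in> L2" by (intro continuous_bounded_L2 continuous_intros)
  have ym: "y \<in> borel_measurable unit_interval" "r \<in> borel_measurable unit_interval"
    using y r by (auto simp: L2_def)
  have yi: "integrable unit_interval y" "integrable unit_interval r"
    using L2_times_integrable[OF y one] L2_times_integrable[OF r one] by simp_all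
  have polym: "poly p \<in> borel_measurable unit_interval" for p
    using poly_L2[of p] by (simp add: L2_def)
  \<comment> \<open>The target is written in the shape of \<open>\<phi>'\<close> with the limits of
    the factors put in (1 for \<open>flat 0\<close>, 0 for \<open>flat 1\<close>), so that the limit
    rules apply term by term.\<close>
  have pd: "poly (pderiv (parabola * s)) t
      = poly (pderiv s) t * (t * (1 - t) * 1) + poly s t * poly (pderiv parabola) t * 1
        + poly s t * poly (pderiv parabola) t * 0" for t
    by (simp add: pderiv_mult poly_parabola algebra_simps)
  have "(\<lambda>m. \<integral>t. y t * deriv (\<phi> m) t \<partial>unit_interval)
     \<longlonglongrightarrow> (\<integral>t. y t * poly (pderiv (parabola * s)) t \<partial>unit_interval)"
  \<comment> \<open>\<open>B\<close> bounds the term with the derivative of \<open>s\<close>; each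
    \<open>A\<close> bounds one of the two other terms, as |1-2t| <= 1 and \<open>flat 0\<close>,
    \<open>flat 1\<close> are at most 1.\<close>
  proof (rule integral_dominated_convergence[where w="\<lambda>t. \<bar>y t\<bar> * (B + A + A)"])
    show "AE t in unit_interval. (\<lambda>m. y t * deriv (\<phi> m) t) \<longlonglongrightarrow> y t * poly (pderiv (parabola * s)) t"
    proof (rule AE_I2)
      fix t assume "t \<in> space unit_interval"
      then have "0 < t" "t < 1" by auto
      then show "(\<lambda>m. y t * deriv (\<phi> m) t) \<longlonglongrightarrow> y t * poly (pderiv (parabola * s)) t"
        unfolding \<phi>' pd
        by (intro tendsto_mult tendsto_add tendsto_const vm flat_0_tendsto flat_1_tendsto vtop)
    qed
    show "AE t in unit_interval. norm (y t * deriv (\<phi> m) t) \<le> \<bar>y t\<bar> * (B + A + A)" for m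
    proof (rule AE_I2)
      fix t assume "t \<in> space unit_interval"
      then have t: "0 < t" "t < 1" by auto
      have w': "\<bar>poly (pderiv parabola) t\<bar> \<le> 1"
        using t by (simp add: parabola_def pderiv_pCons)
      have "\<bar>poly (pderiv s) t * (v m t / real (Suc m) * flat 0 (v m t))\<bar> \<le> B * 1"
        unfolding abs_mult[of "poly (pderiv s) t"]
        using vb[OF t, of m] by (intro mult_mono B t abs_ge_zero) linarith
      moreover have "\<bar>poly s t * poly (pderiv parabola) t * flat j (v m t)\<bar> \<le> A * 1 * 1"
        if "flat j (v m t) \<le> 1" for j
        unfolding abs_mult
        by (intro mult_mono mult_nonneg_nonneg A t w' abs_ge_zero) (use that in \<open>auto simp: flat_nonneg\<close>)
      note this[OF f0] this[OF f1]
      moreover have "\<bar>a + b + c\<bar> \<le> a' + b' + c'"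
        if "\<bar>a\<bar> \<le> a'" "\<bar>b\<bar> \<le> b'" "\<bar>c\<bar> \<le> c'" for a b c a' b' c' :: real
        using that by linarith
      ultimately have "\<bar>deriv (\<phi> m) t\<bar> \<le> B * 1 + A * 1 * 1 + A * 1 * 1"
        unfolding \<phi>' by blast
      then show "norm (y t * deriv (\<phi> m) t) \<le> \<bar>y t\<bar> * (B + A + A)"
        by (simp add: abs_mult mult_left_mono)
    qed
  qed (use yi in \<open>auto intro!: borel_measurable_times ym meas polym simp del: poly_mult\<close>)
  moreover have "(\<lambda>m. \<integral>t. r t * \<phi> m t \<partial>unit_interval)
     \<longlonglongrightarrow> (\<integral>t. r t * poly (parabola * s) t \<partial>unit_interval)"
  proof (rule integral_dominated_convergence[where w="\<lambda>t. \<bar>r t\<bar> * A"])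
    have pd: "poly (parabola * s) t = poly s t * (t * (1 - t) * 1)" for t
      by (simp add: poly_parabola)
    show "AE t in unit_interval. (\<lambda>m. r t * \<phi> m t) \<longlonglongrightarrow> r t * poly (parabola * s) t"
    proof (rule AE_I2)
      fix t assume "t \<in> space unit_interval"
      then have "0 < t" "t < 1" by auto
      then show "(\<lambda>m. r t * \<phi> m t) \<longlonglongrightarrow> r t * poly (parabola * s) t"
        unfolding \<phi> pd by (intro tendsto_mult tendsto_const vm flat_0_tendsto vtop)
    qed
    show "AE t in unit_interval. norm (r t * \<phi> m t) \<le> \<bar>r t\<bar> * A" for m
    proof (rule AE_I2)
      fix t assume "t \<in> space unit_interval"
      then have t: "0 < t" "t < 1" by auto
      have "\<bar>\<phi> m t\<bar> \<le> A * 1"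
        unfolding \<phi> abs_mult[of "poly s t"]
        using vb[OF t, of m] by (intro mult_mono A t abs_ge_zero) linarith
      then show "norm (r t * \<phi> m t) \<le> \<bar>r t\<bar> * A"
        by (simp add: abs_mult mult_left_mono)
    qed
  qed (use yi in \<open>auto intro!: borel_measurable_times ym meas polym simp del: poly_mult\<close>)
  moreover have "(\<integral>t. y t * deriv (\<phi> m) t \<partial>unit_interval) = - (\<integral>t. r t * \<phi> m t \<partial>unit_interval)" for m
    using d cutoff_test_function[of "Suc m" s] by (simp add: has_weak_deriv_def \<phi>_def)
  ultimately show "L2_inner y (poly (pderiv (parabola * s))) = - L2_inner r (poly (parabola * s))"
    unfolding L2_inner_def by (simp add: LIMSEQ_unique tendsto_minus)
qed

section \<open>Successive weak derivatives and the integration operator\<close>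

lemma test_function_deriv:
  assumes "test_function \<phi>"
  shows "test_function (deriv \<phi>)"
proof -
  obtain a b where ab: "0 < a" "b < 1" "\<forall>x. x \<notin> {a..b} \<longrightarrow> \<phi> x = 0"
    using assms unfolding test_function_def by blast
  have "deriv \<phi> x = 0" if "x \<notin> {a..b}" for x
  proof (rule DERIV_imp_deriv, rule has_field_derivative_transform_within_open)
    show "((\<lambda>x. 0) has_real_derivative 0) (at x)" by simp
    show "open (- {a..b})" by auto
  qed (use that ab in auto)
  moreover have "(deriv ^^ n) (deriv \<phi>) differentiable (at x)" for n x
    using assms unfolding test_function_def by (metis funpow_Suc_right comp_apply)
  ultimately show ?thesis using ab unfolding test_function_def by blast
qed

text \<open>Testing the i-th derivative against \<open>deriv \<phi>\<close> and the next one against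
  \<open>\<phi>\<close> produces the same left-hand side; the common sign (-1)^i cancels. This turns
  the derivatives of \<open>x\<close> into a chain of first-order relations.\<close>

lemma has_weak_deriv_Suc:
  assumes "has_weak_deriv i x y" "has_weak_deriv (Suc i) x r"
  shows "has_weak_deriv 1 y r"
  unfolding has_weak_deriv_def
proof (intro allI impI)
  fix \<phi> assume \<phi>: "test_function \<phi>"
  have "(deriv ^^ i) (deriv \<phi>) = (deriv ^^ Suc i) \<phi>" by (simp add: funpow_swap1)
  moreover have "(\<integral>t. x t * (deriv ^^ i) (deriv \<phi>) t \<partial>unit_interval)
      = (-1) ^ i * (\<integral>t. y t * deriv \<phi> t \<partial>unit_interval)"
    using assms(1) test_function_deriv[OF \<phi>] unfolding has_weak_deriv_def by blast
  moreover have "(\<integral>t. x t * (deriv ^^ Suc i) \<phi> t \<partial>unit_interval)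
      = (-1) ^ Suc i * (\<integral>t. r t * \<phi> t \<partial>unit_interval)"
    using assms(2) \<phi> unfolding has_weak_deriv_def by blast
  ultimately have "(-1) ^ i * (\<integral>t. y t * deriv \<phi> t \<partial>unit_interval)
      = (-1) ^ i * - (\<integral>t. r t * \<phi> t \<partial>unit_interval)"
    by (simp only:) simp
  then have "(\<integral>t. y t * deriv \<phi> t \<partial>unit_interval) = - (\<integral>t. r t * \<phi> t \<partial>unit_interval)"
    by (simp only: mult_cancel_left) simp
  then show "(\<integral>t. y t * (deriv ^^ 1) \<phi> t \<partial>unit_interval) = (-1) ^ 1 * (\<integral>t. r t * \<phi> t \<partial>unit_interval)"
    by simp
qed

text \<open>Fubini on the triangle t < s. Integrating Q' over (t,1) gives -Q(t), because Q = t(1-t)p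
  vanishes at 1. The function \<open>x\<close> is merely square-integrable, and pointwise
  differentiation of its primitive is avoided.\<close>

lemma has_poly_deriv_integration_op:
  assumes x: "x \<in> L2"
  shows "has_poly_deriv (integration_op x) x"
  unfolding has_poly_deriv_def
proof
  fix p
  define Q where "Q = parabola * p"
  interpret F: finite_measure unit_interval by (rule finite_measure_unit_interval)
  interpret P: pair_sigma_finite unit_interval unit_interval ..
  have one: "(\<lambda>t. 1) \<in> L2" by (intro continuous_bounded_L2 continuous_intros)
  have [measurable]: "x \<in> borel_measurable unit_interval" using x by (simp add: L2_def)
  have [measurable]: "(\<lambda>t. t) \<in> borel_measurable unit_interval"
    by (intro continuous_imp_measurable_on_sets_lebesgue continuous_intros) auto
  have [measurable]: "poly (pderiv Q) \<in> borel_measurable unit_interval"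
    using poly_L2[of "pderiv Q"] by (simp add: L2_def)
  have xi: "integrable unit_interval x" using L2_times_integrable[OF x one] by simp
  have qi: "integrable unit_interval (poly (pderiv Q))"
    using L2_times_integrable[OF poly_L2 one] by simp
  have 1: "integrable (unit_interval \<Otimes>\<^sub>M unit_interval) (\<lambda>(s, t). poly (pderiv Q) s * x t)"
    by (rule P.Fubini_integrable) (use xi qi in \<open>auto simp: abs_mult\<close>)
  have 2: "integrable (unit_interval \<Otimes>\<^sub>M unit_interval)
      (\<lambda>(s, t). if t < s then poly (pderiv Q) s * x t else 0)"
    by (rule Bochner_Integration.integrable_bound[OF 1]) auto
  have J: "integration_op x s * poly (pderiv Q) s
      = (\<integral>t. (if t < s then poly (pderiv Q) s * x t else 0) \<partial>unit_interval)" if "0 < s" "s < 1" for s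
  proof -
    have "integration_op x s = (\<integral>t. indicator {0<..<s} t * x t \<partial>lebesgue)"
      unfolding integration_op_def by (subst integral_restrict_space) auto
    also have "\<dots> = (\<integral>t. indicator {0<..<1} t * (if t < s then x t else 0) \<partial>lebesgue)"
      by (intro Bochner_Integration.integral_cong) (use that in \<open>auto simp: indicator_def\<close>)
    also have "\<dots> = (\<integral>t. (if t < s then x t else 0) \<partial>unit_interval)"
      by (subst integral_restrict_space) auto
    finally have "integration_op x s * poly (pderiv Q) s
        = (\<integral>t. (if t < s then x t else 0) * poly (pderiv Q) s \<partial>unit_interval)"
      by simp
    also have "\<dots> = (\<integral>t. (if t < s then poly (pderiv Q) s * x t else 0) \<partial>unit_interval)"
      by (intro Bochner_Integration.integral_cong) auto
    finally show ?thesis .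
  qed
  have Q: "(\<integral>s. (if t < s then poly (pderiv Q) s * x t else 0) \<partial>unit_interval) = - (x t * poly Q t)"
    if "0 < t" "t < 1" for t
  proof -
    have "(\<integral>s. (if t < s then poly (pderiv Q) s else 0) \<partial>unit_interval)
       = (\<integral>s. indicator {0<..<1} s * (if t < s then poly (pderiv Q) s else 0) \<partial>lebesgue)"
      by (subst integral_restrict_space) auto
    also have "\<dots> = (\<integral>s. indicator {t<..<1} s * poly (pderiv Q) s \<partial>lebesgue)"
      by (intro Bochner_Integration.integral_cong) (use that in \<open>auto simp: indicator_def\<close>)
    also have "\<dots> = (\<integral>s. poly (pderiv Q) s \<partial>lebesgue_on {t<..<1})"
      by (subst integral_restrict_space) auto
    also have "\<dots> = integral {t<..<1} (poly (pderiv Q))"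
    proof (intro lebesgue_integral_eq_integral)
      have "set_integrable lebesgue {0<..<1} (poly (pderiv Q))"
        using qi by (simp add: set_integrable_def integrable_restrict_space)
      then have "set_integrable lebesgue {t<..<1} (poly (pderiv Q))"
        by (rule set_integrable_subset) (use that in auto)
      then show "integrable (lebesgue_on {t<..<1}) (poly (pderiv Q))"
        by (simp add: set_integrable_def integrable_restrict_space)
    qed auto
    also have "\<dots> = integral {t..1} (poly (pderiv Q))"
      by (simp add: integral_open_interval_real)
    also have "\<dots> = poly Q 1 - poly Q t"
      using that by (intro integral_unique fundamental_theorem_of_calculus)
      (auto intro!: DERIV_subset[OF poly_DERIV] simp: has_real_derivative_iff_has_vector_derivative[symmetric])
    also have "\<dots> = - poly Q t" by (simp add: Q_def poly_parabola)
    finally have "(\<integral>s. x t * (if t < s then poly (pderiv Q) s else 0) \<partial>unit_interval) = x t * - poly Q t"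
      by simp
    moreover have "(\<integral>s. x t * (if t < s then poly (pderiv Q) s else 0) \<partial>unit_interval)
        = (\<integral>s. (if t < s then poly (pderiv Q) s * x t else 0) \<partial>unit_interval)"
      by (intro Bochner_Integration.integral_cong) auto
    ultimately show ?thesis by simp
  qed
  have "L2_inner (integration_op x) (poly (pderiv Q))
      = (\<integral>s. (\<integral>t. (if t < s then poly (pderiv Q) s * x t else 0) \<partial>unit_interval) \<partial>unit_interval)"
    unfolding L2_inner_def by (intro Bochner_Integration.integral_cong J) auto
  also have "\<dots> = (\<integral>t. (\<integral>s. (if t < s then poly (pderiv Q) s * x t else 0) \<partial>unit_interval) \<partial>unit_interval)"
    by (rule P.Fubini_integral[symmetric]) (use 2 in \<open>simp add: case_prod_unfold\<close>)
  also have "\<dots> = (\<integral>t. - (x t * poly Q t) \<partial>unit_interval)"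
    by (intro Bochner_Integration.integral_cong Q) auto
  finally show "L2_inner (integration_op x) (poly (pderiv (parabola * p))) = - L2_inner x (poly (parabola * p))"
    by (simp add: L2_inner_def Q_def)
qed

section \<open>Choice of the degree\<close>

lemma eventually_at_right_0_ln_inverse:
  fixes P :: "real \<Rightarrow> bool"
  assumes "eventually P at_top"
  shows "\<forall>\<^sub>F \<delta> in at_right 0. P (ln (1 / \<delta>))"
proof -
  have "filterlim (\<lambda>\<delta>::real. - ln \<delta>) at_top (at_right 0)"
    using ln_at_0 by (simp add: filterlim_uminus_at_bot)
  with assms have "\<forall>\<^sub>F \<delta> in at_right 0. P (- ln \<delta>)"
    by (rule eventually_compose_filterlim)
  then show ?thesis
    using eventually_at_right_less[of 0] by eventually_elim (simp add: ln_div)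
qed

lemma optimal_degree_bound:
  fixes E L :: real
  assumes E: "\<And>n. E \<le> 1 / (real n + 1) ^ (2 * k) + 9 * 216 ^ (n + k) * (exp (- L))\<^sup>2"
    and L: "0 < L" "9 * 216 ^ k * (L ^ (2 * k) / exp L) \<le> 1"
  shows "E \<le> ((8 ^ k + 1) / L ^ k)\<^sup>2"
proof -
  \<comment> \<open>The divisor 8 comes from 216 < 2^8 <= exp 8: then 216^n <= exp(8n) <= exp L, and
    the factor exp(-2L) leaves exp(-L), which the second assumption on \<open>L\<close>
    absorbs.\<close>
  define n where "n = nat \<lfloor>L / 8\<rfloor>"
  have n: "real n \<le> L / 8" "L / 8 \<le> real n + 1" using L of_int_floor_le[of "L / 8"] by (auto simp: n_def)
  have "1 / (real n + 1) ^ (2 * k) \<le> 1 / (L / 8) ^ (2 * k)"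
    using n L by (intro divide_left_mono power_mono mult_pos_pos) auto
  also have "\<dots> = (8 ^ k)\<^sup>2 / (L ^ k)\<^sup>2" 
    by (simp add: power_divide flip: power_mult) (simp add: mult.commute)
  finally have 1: "1 / (real n + 1) ^ (2 * k) \<le> (8 ^ k)\<^sup>2 / (L ^ k)\<^sup>2" .
  have "(2::real) ^ 8 \<le> exp 1 ^ 8"
    using exp_ge_add_one_self[of 1] by (intro power_mono) auto
  then have "(216::real) \<le> exp 8" by (simp flip: exp_of_nat_mult)
  then have "(216::real) ^ n \<le> exp 8 ^ n" by (intro power_mono) auto
  also have "\<dots> = exp (real n * 8)" by (simp only: exp_of_nat_mult)
  also have "\<dots> \<le> exp L" using n by simp
  finally have "216 ^ n * (exp (- L))\<^sup>2 \<le> exp L * (exp (- L))\<^sup>2" by (intro mult_right_mono) auto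
  also have "\<dots> = 1 / exp L" by (simp add: power2_eq_square exp_minus divide_simps)
  finally have "9 * 216 ^ k * (216 ^ n * (exp (- L))\<^sup>2) \<le> 9 * 216 ^ k * (1 / exp L)"
    by (intro mult_left_mono) auto
  also have "\<dots> \<le> 1 / (L ^ k)\<^sup>2"
  proof -
    have "L ^ (2 * k) = (L ^ k)\<^sup>2" by (simp add: mult.commute flip: power_mult)
    then show ?thesis using L by (simp add: le_divide_eq)
  qed
  finally have "9 * 216 ^ (n + k) * (exp (- L))\<^sup>2 \<le> 1 / (L ^ k)\<^sup>2" by (simp add: power_add mult_ac)
  with 1 E[of n] have "E \<le> ((8 ^ k)\<^sup>2 + 1) / (L ^ k)\<^sup>2" by (simp add: add_divide_distrib)
  also have "\<dots> \<le> (8 ^ k + 1)\<^sup>2 / (L ^ k)\<^sup>2"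
    by (intro divide_right_mono) (auto simp: power2_sum)
  finally show ?thesis by (simp add: power_divide)
qed

text \<open>Common form of both bounds: \<open>f\<close> is the identity for the Sobolev case, and
  \<open>integration_op\<close> with k = 1 for the other. Taking the supremum in
  \<open>ereal\<close> requires no boundedness beforehand.\<close>

lemma eventually_L2_norm_le:
  assumes S: "\<And>\<delta> x. x \<in> S \<delta> \<Longrightarrow> f x \<in> L2 \<and> ell2_norm (hausdorff_moments (f x)) \<le> \<delta> \<and>
    (\<forall>n. legendre_error (n + k) (f x) \<le> 1 / (real n + 1) ^ (2 * k))"
  shows "\<forall>\<^sub>F \<delta> in at_right 0. (SUP x \<in> S \<delta>. ereal (L2_norm (f x))) \<le> ereal ((8 ^ k + 1) / ln (1 / \<delta>) ^ k)"
proof -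
  have "((\<lambda>L::real. 9 * 216 ^ k * (L ^ (2 * k) / exp L)) \<longlongrightarrow> 9 * 216 ^ k * 0) at_top"
    by (intro tendsto_mult tendsto_const tendsto_power_div_exp_0)
  then have "\<forall>\<^sub>F L in at_top. 9 * 216 ^ k * (L ^ (2 * k) / exp L) < (1::real)"
    by (rule order_tendstoD) simp
  then have "\<forall>\<^sub>F \<delta> in at_right 0. 9 * 216 ^ k * (ln (1 / \<delta>) ^ (2 * k) / exp (ln (1 / \<delta>))) < (1::real)"
    by (rule eventually_at_right_0_ln_inverse)
  moreover have "\<forall>\<^sub>F \<delta> in at_right 0. (0::real) < ln (1 / \<delta>)"
    by (rule eventually_at_right_0_ln_inverse) (rule eventually_gt_at_top)
  ultimately show ?thesis
    using eventually_at_right_less[of 0]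
  proof eventually_elim
    fix \<delta> :: real
    assume L: "9 * 216 ^ k * (ln (1 / \<delta>) ^ (2 * k) / exp (ln (1 / \<delta>))) < 1" "0 < ln (1 / \<delta>)"
      and "0 < \<delta>"
    then have \<delta>: "exp (- ln (1 / \<delta>)) = \<delta>" by (simp add: ln_div)
    show "(SUP x \<in> S \<delta>. ereal (L2_norm (f x))) \<le> ereal ((8 ^ k + 1) / ln (1 / \<delta>) ^ k)"
    proof (rule SUP_least)
      fix x assume "x \<in> S \<delta>"
      note x = S[OF this]
      have "(L2_norm (f x))\<^sup>2 \<le> ((8 ^ k + 1) / ln (1 / \<delta>) ^ k)\<^sup>2"
        unfolding L2_norm_sq
      proof (rule optimal_degree_bound)
        fix n
        show "L2_inner (f x) (f x) \<le> 1 / (real n + 1) ^ (2 * k) + 9 * 216 ^ (n + k) * (exp (- ln (1 / \<delta>)))\<^sup>2"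
          unfolding \<delta> using L2_inner_le_moments[of "f x" \<delta> "n + k"] x
          by (meson add_right_mono order_trans)
      qed (use L in auto)
      then have "L2_norm (f x) \<le> (8 ^ k + 1) / ln (1 / \<delta>) ^ k"
        by (rule power2_le_imp_le) (use L in auto)
      then show "ereal (L2_norm (f x)) \<le> ereal ((8 ^ k + 1) / ln (1 / \<delta>) ^ k)" by simp
    qed
  qed
qed

lemma legendre_error_Sobolev_le:
  assumes x: "x \<in> Sobolev k" and "1 \<le> k" and "Sobolev_norm k x \<le> 1"
  shows "legendre_error (n + k) x \<le> 1 / (real n + 1) ^ (2 * k)"
proof -
  \<comment> \<open>The chain has to start at \<open>x\<close> itself: \<open>weak_deriv 0 x\<close>
    is a chosen representative and need not be the same function. As k >= 1, the last member is
    \<open>weak_deriv k x\<close>, whose norm enters \<open>Sobolev_norm\<close>.\<close>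
  define g where "g i = (if i = 0 then x else weak_deriv i x)" for i
  have wd: "weak_deriv i x \<in> L2 \<and> has_weak_deriv i x (weak_deriv i x)" if "i \<le> k" for i
  proof -
    have "\<exists>h. h \<in> L2 \<and> has_weak_deriv i x h"
      using x that unfolding Sobolev_def by blast
    then show ?thesis unfolding weak_deriv_def by (rule someI_ex)
  qed
  have g: "g i \<in> L2" "has_weak_deriv i x (g i)" if "i \<le> k" for i
    using wd[OF that] x by (auto simp: g_def Sobolev_def has_weak_deriv_def)
  have "has_poly_deriv (g i) (g (Suc i))" if "i < k" for i
    using that g by (intro weak_deriv_imp_has_poly_deriv has_weak_deriv_Suc[of i x]) auto
  then have "legendre_error (n + k) (g 0) \<le> L2_inner (g k) (g k) / (real n + 1) ^ (2 * k)"
    using g by (intro legendre_error_deriv_chain) auto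
  also have "\<dots> \<le> 1 / (real n + 1) ^ (2 * k)"
  proof (rule divide_right_mono)
    have "L2_inner (g k) (g k) = (L2_norm (weak_deriv k x))\<^sup>2"
      using \<open>1 \<le> k\<close> by (simp add: g_def L2_norm_sq)
    also have "\<dots> \<le> (\<Sum>i\<le>k. (L2_norm (weak_deriv i x))\<^sup>2)"
      by (rule member_le_sum) auto
    also have "\<dots> \<le> 1"
      using assms(3) by (simp add: Sobolev_norm_def)
    finally show "L2_inner (g k) (g k) \<le> 1" .
  qed simp
  finally show ?thesis by (simp add: g_def)
qed

lemma legendre_error_integration_op_le:
  assumes x: "x \<in> L2" and "L2_norm x \<le> 1"
  shows "legendre_error (n + 1) (integration_op x) \<le> 1 / (real n + 1) ^ (2 * 1)"
proof -
  define g where "g i = (if i = 0 then integration_op x else x)" for i :: nat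
  have "legendre_error (n + 1) (g 0) \<le> L2_inner (g 1) (g 1) / (real n + 1) ^ (2 * 1)"
    using x by (intro legendre_error_deriv_chain)
      (auto simp: g_def integration_op_in_L2 has_poly_deriv_integration_op)
  also have "\<dots> \<le> 1 / (real n + 1) ^ (2 * 1)"
  proof (rule divide_right_mono)
    have "0 \<le> L2_norm x" by (simp add: L2_norm_def)
    then have "(L2_norm x)\<^sup>2 \<le> 1" using assms(2) by (simp add: power_le_one)
    then show "L2_inner (g 1) (g 1) \<le> 1" by (simp add: g_def L2_norm_sq)
  qed simp
  finally show ?thesis by (simp add: g_def)
qed

theorem theorem2:
  shows "\<exists>C :: nat \<Rightarrow> real. (\<forall>k. C k > 0) \<and>
     (\<forall>k\<ge>1. \<forall>\<^sub>F \<delta> in at_right 0.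
        (SUP x \<in> {x \<in> Sobolev k. ell2_norm (hausdorff_moments x) \<le> \<delta> \<and> Sobolev_norm k x \<le> 1}.
           ereal (L2_norm x)) \<le> ereal (C k / (ln (1 / \<delta>)) ^ k)) \<and>
     (\<forall>\<^sub>F \<delta> in at_right 0.
        (SUP x \<in> {x \<in> L2. ell2_norm (hausdorff_moments (integration_op x)) \<le> \<delta> \<and> L2_norm x \<le> 1}.
           ereal (L2_norm (integration_op x))) \<le> ereal (C 0 / ln (1 / \<delta>)))"
\<comment> \<open>The integration operator gains one derivative, so its constant is the value 8^1 +
  1 = 9 of the case k = 1, stored at index 0.\<close>
proof (intro exI[of _ "\<lambda>k. if k = 0 then 9 else 8 ^ k + 1"] conjI allI impI)
  fix k :: nat
  show "0 < (if k = 0 then 9 else 8 ^ k + 1 :: real)" by (simp add: add_pos_pos)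
  assume k: "1 \<le> k"
  have "\<forall>\<^sub>F \<delta> in at_right 0.
    (SUP x \<in> {x \<in> Sobolev k. ell2_norm (hausdorff_moments x) \<le> \<delta> \<and> Sobolev_norm k x \<le> 1}.
       ereal (L2_norm x)) \<le> ereal ((8 ^ k + 1) / (ln (1 / \<delta>)) ^ k)"
    by (rule eventually_L2_norm_le)
      (use k legendre_error_Sobolev_le in \<open>auto simp: Sobolev_def\<close>)
  with k show "\<forall>\<^sub>F \<delta> in at_right 0.
    (SUP x \<in> {x \<in> Sobolev k. ell2_norm (hausdorff_moments x) \<le> \<delta> \<and> Sobolev_norm k x \<le> 1}.
       ereal (L2_norm x)) \<le> ereal ((if k = 0 then 9 else 8 ^ k + 1) / (ln (1 / \<delta>)) ^ k)"
    by simp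
next
  have "\<forall>\<^sub>F \<delta> in at_right 0.
    (SUP x \<in> {x \<in> L2. ell2_norm (hausdorff_moments (integration_op x)) \<le> \<delta> \<and> L2_norm x \<le> 1}.
       ereal (L2_norm (integration_op x))) \<le> ereal ((8 ^ 1 + 1) / ln (1 / \<delta>) ^ 1)"
    by (rule eventually_L2_norm_le)
      (use legendre_error_integration_op_le integration_op_in_L2 in blast)
  then show "\<forall>\<^sub>F \<delta> in at_right 0.
    (SUP x \<in> {x \<in> L2. ell2_norm (hausdorff_moments (integration_op x)) \<le> \<delta> \<and> L2_norm x \<le> 1}.
       ereal (L2_norm (integration_op x))) \<le> ereal ((if (0::nat) = 0 then 9 else 8 ^ 0 + 1) / ln (1 / \<delta>))"
    by simp
qed

end
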